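(* Let $d\geq 1$ be an integer and fix a semi-algebraic description, i.e. an ambient dimension $D\geq 1$, polynomials $f_1,\dots,f_s\in\mathbb{R}[x_1,\dots,x_D,y_1,\dots,y_D]$ and a Boolean formula $\Phi$ in the atoms $f_j\geq 0$, $f_j=0$ ($1\le j\le s$). For every $\epsilon>0$ there exists $\beta>0$ (depending on $\epsilon$, $d$ and the fixed description) such that the following holds: if $G$ is a graph whose vertex set is a finite set $P\subset\mathbb{R}^D$ of $n$ points, in which two distinct points $p,q$ are adjacent if and only if $\Phi$ holds at $(p,q)$, and $G$ has more than $(1-\frac{1}{d}+\epsilon)\frac{n^2}{2}$ edges, then $G$ contains a complete $(d+1)$-partite subgraph whose $d+1$ classes are pairwise disjoint vertex sets each of size at least $\lfloor\beta n\rfloor$ (i.e. every vertex of one class is adjacent to every vertex of each other class).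
   Context: A graph is semi-algebraic (with a given description) if its vertices are points of $\mathbb{R}^D$ and its edges are the pairs of points $(p,q)$ satisfying a fixed Boolean combination of a fixed number of polynomial equations and inequalities in the $2D$ coordinates of $p$ and $q$ (the relation is assumed symmetric so that it defines an undirected graph). *)

theory Defs
  imports "HOL-Analysis.Finite_Cartesian_Product" "HOL-Library.Poly_Mapping" "HOL-Library.Disjoint_Sets"
begin

text \<open>Real polynomials in variables of type \<open>'v\<close>: finitely supported maps from monomials
  (finitely supported exponent vectors) to coefficients.\<close>

type_synonym 'v real_mpoly = "('v \<Rightarrow>\<^sub>0 nat) \<Rightarrow>\<^sub>0 real"

definition eval_mpoly :: "'v real_mpoly \<Rightarrow> ('v \<Rightarrow> real) \<Rightarrow> real" where
  "eval_mpoly f x =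
     (\<Sum>m\<in>Poly_Mapping.keys f. Poly_Mapping.lookup f m *
        (\<Prod>v\<in>Poly_Mapping.keys m. x v ^ Poly_Mapping.lookup m v))"

text \<open>The coordinates \<open>x\<^sub>i\<close> of the first point are the variables \<open>Inl i\<close>, the coordinates
  \<open>y\<^sub>i\<close> of the second point the variables \<open>Inr i\<close>.\<close>

definition eval_pair :: "('n::finite + 'n) real_mpoly \<Rightarrow> real ^ 'n \<Rightarrow> real ^ 'n \<Rightarrow> real" where
  "eval_pair f p q = eval_mpoly f (case_sum (\<lambda>i. p $ i) (\<lambda>i. q $ i))"

text \<open>\<open>Nonneg j\<close> and \<open>Zero j\<close> stand for the atoms \<open>f\<^sub>j \<ge> 0\<close> and \<open>f\<^sub>j = 0\<close>;
  \<open>indices\<close> is the set of all \<open>j\<close> occurring in a formula.\<close>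

datatype (indices: 'j) sa_formula =
    Nonneg 'j
  | Zero 'j
  | Truth
  | Neg "'j sa_formula"
  | Conj "'j sa_formula" "'j sa_formula"
  | Disj "'j sa_formula" "'j sa_formula"

primrec sa_holds ::
  "('j \<Rightarrow> ('n::finite + 'n) real_mpoly) \<Rightarrow> 'j sa_formula \<Rightarrow> real ^ 'n \<Rightarrow> real ^ 'n \<Rightarrow> bool" where
  "sa_holds f (Nonneg j) p q \<longleftrightarrow> eval_pair (f j) p q \<ge> 0"
| "sa_holds f (Zero j) p q \<longleftrightarrow> eval_pair (f j) p q = 0"
| "sa_holds f Truth p q \<longleftrightarrow> True"
| "sa_holds f (Neg \<phi>) p q \<longleftrightarrow> \<not> sa_holds f \<phi> p q"
| "sa_holds f (Conj \<phi> \<psi>) p q \<longleftrightarrow> sa_holds f \<phi> p q \<and> sa_holds f \<psi> p q"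
| "sa_holds f (Disj \<phi> \<psi>) p q \<longleftrightarrow> sa_holds f \<phi> p q \<or> sa_holds f \<psi> p q"

definition simple_graph :: "'a set \<Rightarrow> 'a set set \<Rightarrow> bool" where
  "simple_graph V E \<longleftrightarrow> finite V \<and> E \<subseteq> {{u, v} |u v. u \<in> V \<and> v \<in> V \<and> u \<noteq> v}"

text \<open>Since edges are unordered pairs, this forces the relation defined by the formula to be
  symmetric on distinct points of \<open>P\<close>; nothing is required outside \<open>P\<close>.\<close>

definition semialgebraic_graph ::
  "('j \<Rightarrow> ('n::finite + 'n) real_mpoly) \<Rightarrow> 'j sa_formula \<Rightarrow>
    (real ^ 'n) set \<Rightarrow> (real ^ 'n) set set \<Rightarrow> bool" where
  "semialgebraic_graph f \<Phi> P E \<longleftrightarrow> simple_graph P E \<and>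
     (\<forall>p\<in>P. \<forall>q\<in>P. p \<noteq> q \<longrightarrow> ({p, q} \<in> E \<longleftrightarrow> sa_holds f \<Phi> p q))"

definition complete_multipartite_subgraph ::
  "'i set \<Rightarrow> ('i \<Rightarrow> 'a set) \<Rightarrow> 'a set \<Rightarrow> 'a set set \<Rightarrow> bool" where
  "complete_multipartite_subgraph I C V E \<longleftrightarrow>
     (\<forall>i\<in>I. C i \<subseteq> V) \<and> disjoint_family_on C I \<and>
     (\<forall>i\<in>I. \<forall>j\<in>I. i \<noteq> j \<longrightarrow> (\<forall>u\<in>C i. \<forall>v\<in>C j. {u, v} \<in> E))"

end

theory Submission
  imports Defs "Jordan_Normal_Form.Determinant" "HOL-Analysis.Convex"
begin

text \<open>
  Each atom is a half-space condition \<open>\<langle>h q, \<phi> p\<rangle> \<ge> 0\<close> on the vector of monomials of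
  the first point. If no hyperplane contains half of the vectors, most of them split into bases,
  and by a Hadamard-type bound the potential \<open>\<Sum> ln |T v|\<^sup>2 - m ln (det T)\<^sup>2\<close> is
  bounded below over invertible \<open>T\<close>. At a near-minimiser the directions \<open>T v / |T v|\<close> have
  a sizeable component along every direction, so cutting the unit sphere into boundedly many small
  cells leaves every half-space constant on cells holding a fixed fraction of the points; otherwise
  one coordinate is eliminated. Iterating inside the cells makes the fraction on which a half-space is
  not constant arbitrarily small. Grouping the second points by their behaviour on the cells yields a
  partition into boundedly many parts with almost all pairs of points in homogeneous pairs of parts.
  Deleting the remaining pairs and the small parts costs at most \<open>\<epsilon>n\<^sup>2\<close> ordered pairs,
  so Turan's theorem gives a clique whose vertices lie in large, mutually complete parts.
\<close>

section \<open>Determinants of real arrays\<close>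

text \<open>The dimension will be the number of monomials of a polynomial, which is not a type; hence
  vectors are functions on \<open>nat\<close> of which only the first \<open>N\<close> values count.\<close>

definition array_det :: "nat \<Rightarrow> (nat \<Rightarrow> nat \<Rightarrow> real) \<Rightarrow> real" where
  "array_det N T = det (mat N N (\<lambda>(i, j). T i j))"

lemma array_det_leibniz:
  "array_det N T = (\<Sum>p | p permutes {..<N}. signof p * (\<Prod>i<N. T i (p i)))"
proof -
  have "array_det N T = (\<Sum>p | p permutes {0..<N}. signof p * (\<Prod>i = 0..<N. mat N N (\<lambda>(i, j). T i j) $$ (i, p i)))"
    unfolding array_det_def by (rule det_def') simp
  also have "\<dots> = (\<Sum>p | p permutes {0..<N}. signof p * (\<Prod>i = 0..<N. T i (p i)))"
  proof (intro sum.cong refl arg_cong2[where f = "(*)"] prod.cong)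
    fix p i assume "p \<in> {p. p permutes {0..<N}}" and i: "i \<in> {0..<N}"
    then have "p i \<in> {0..<N}" by (simp add: permutes_in_image)
    with i show "mat N N (\<lambda>(i, j). T i j) $$ (i, p i) = T i (p i)" by simp
  qed
  finally show ?thesis by (simp add: atLeast0LessThan)
qed

lemma array_det_mult:
  "array_det N (\<lambda>i j. \<Sum>k<N. A i k * B k j) = array_det N A * array_det N B"
proof -
  have "mat N N (\<lambda>(i, j). \<Sum>k<N. A i k * B k j)
      = mat N N (\<lambda>(i, j). A i j) * mat N N (\<lambda>(i, j). B i j)"
    by (rule eq_matI) (auto simp: scalar_prod_def atLeast0LessThan)
  then show ?thesis unfolding array_det_def by (simp add: det_mult[of _ N])
qed

lemma array_det_transpose: "array_det N (\<lambda>i j. T j i) = array_det N T"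
proof -
  have "mat N N (\<lambda>(i, j). T j i) = transpose_mat (mat N N (\<lambda>(i, j). T i j))"
    by (rule eq_matI) auto
  then show ?thesis unfolding array_det_def by (simp add: det_transpose[of _ N])
qed

text \<open>A crude Hadamard inequality: each of the N! Leibniz terms is at most the product of the
  Euclidean row lengths. The lost factor is harmless, since after taking logarithms it enters only
  through an additive constant depending on \<open>N\<close>.\<close>

lemma array_det_square_le:
  "(array_det N T)\<^sup>2 \<le> (fact N)\<^sup>2 * (\<Prod>i<N. \<Sum>j<N. (T i j)\<^sup>2)"
proof -
  define r where "r i = sqrt (\<Sum>j<N. (T i j)\<^sup>2)" for i
  have "\<bar>array_det N T\<bar> \<le> (\<Sum>p | p permutes {..<N}. \<bar>signof p * (\<Prod>i<N. T i (p i))\<bar>)"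
    unfolding array_det_leibniz by (rule sum_abs)
  also have "\<dots> \<le> (\<Sum>p | p permutes {..<N}. \<Prod>i<N. r i)"
  proof (rule sum_mono)
    fix p assume "p \<in> {p. p permutes {..<N}}"
    then have p: "p permutes {..<N}" by simp
    have "\<bar>signof p * (\<Prod>i<N. T i (p i))\<bar> = (\<Prod>i<N. \<bar>T i (p i)\<bar>)"
      by (simp add: abs_mult abs_prod sign_def)
    also have "\<dots> \<le> (\<Prod>i<N. r i)"
    proof (intro prod_mono conjI abs_ge_zero)
      fix i assume "i \<in> {..<N}"
      then have "p i \<in> {..<N}" using p by (simp only: permutes_in_image)
      then have "(T i (p i))\<^sup>2 \<le> (\<Sum>j<N. (T i j)\<^sup>2)"
        by (intro member_le_sum) auto
      then show "\<bar>T i (p i)\<bar> \<le> r i"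
        unfolding r_def using real_le_rsqrt by (metis real_sqrt_abs real_sqrt_le_mono)
    qed
    finally show "\<bar>signof p * (\<Prod>i<N. T i (p i))\<bar> \<le> (\<Prod>i<N. r i)" .
  qed
  also have "\<dots> = fact N * (\<Prod>i<N. r i)"
    by (simp add: card_permutations[of "{..<N}" N])
  finally have "(array_det N T)\<^sup>2 \<le> (fact N * (\<Prod>i<N. r i))\<^sup>2"
    by (metis abs_ge_zero power2_abs power_mono)
  also have "\<dots> = (fact N)\<^sup>2 * (\<Prod>i<N. (r i)\<^sup>2)"
    by (simp add: power_mult_distrib prod_power_distrib)
  also have "(\<Prod>i<N. (r i)\<^sup>2) = (\<Prod>i<N. \<Sum>j<N. (T i j)\<^sup>2)"
    unfolding r_def by (intro prod.cong refl real_sqrt_pow2 sum_nonneg) auto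
  finally show ?thesis .
qed

lemma array_det_zero_kernel:
  assumes "array_det N T = 0"
  obtains g where "\<exists>i<N. g i \<noteq> 0" and "\<And>i. i < N \<Longrightarrow> (\<Sum>j<N. T i j * g j) = 0"
proof -
  let ?A = "mat N N (\<lambda>(i, j). T i j)"
  have A: "?A \<in> carrier_mat N N" by simp
  obtain v where v: "v \<in> carrier_vec N" "v \<noteq> 0\<^sub>v N" "?A *\<^sub>v v = 0\<^sub>v N"
    using assms det_0_iff_vec_prod_zero[OF A] unfolding array_det_def by blast
  show thesis
  proof (rule that[of "vec_index v"])
    show "\<exists>i<N. vec_index v i \<noteq> 0"
      using v(1,2) by (metis eq_vecI carrier_vecD index_zero_vec)
    fix i assume i: "i < N"
    then have "vec_index (?A *\<^sub>v v) i = 0" using v(3) by simp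
    then show "(\<Sum>j<N. T i j * vec_index v j) = 0"
      using i v(1) by (simp add: scalar_prod_def atLeast0LessThan)
  qed
qed

lemma array_det_zero_row:
  assumes "k < N" "\<And>j. j < N \<Longrightarrow> T k j = 0"
  shows "array_det N T = 0"
  unfolding array_det_leibniz
proof (rule sum.neutral, rule ballI)
  fix p assume "p \<in> {p. p permutes {..<N}}"
  then have "p k < N" using assms(1) by (metis lessThan_iff mem_Collect_eq permutes_in_image)
  then have "T k (p k) = 0" by (rule assms(2))
  then have "(\<Prod>i<N. T i (p i)) = 0" using assms(1) by (auto simp: prod_zero_iff)
  then show "signof p * (\<Prod>i<N. T i (p i)) = 0" by simp
qed

lemma array_det_triangular:
  assumes "\<And>i j. j < i \<Longrightarrow> i < N \<Longrightarrow> T i j = 0"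
  shows "array_det N T = (\<Prod>i<N. T i i)"
proof -
  have "upper_triangular (mat N N (\<lambda>(i, j). T i j))"
    using assms by (auto simp: upper_triangular_def)
  then have "array_det N T = prod_list (diag_mat (mat N N (\<lambda>(i, j). T i j)))"
    unfolding array_det_def by (rule det_upper_triangular[where n = N]) simp
  also have "\<dots> = (\<Prod>i<N. T i i)" by (simp add: prod_list_diag_prod atLeast0LessThan)
  finally show ?thesis .
qed

text \<open>The replacement is left multiplication by the identity matrix with row \<open>k\<close>
  overwritten by \<open>h\<close>, whose determinant is \<open>h k\<close>.\<close>

lemma array_det_replace_row:
  assumes k: "k < N"
  shows "array_det N (\<lambda>i j. if i = k then \<Sum>l<N. h l * T l j else T i j) = h k * array_det N T"
proof -
  define R where "R i j = (if i = k then h j else if i = j then 1 else 0)" for i j :: nat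
  have "(\<Sum>l<N. R i l * T l j) = (if i = k then \<Sum>l<N. h l * T l j else T i j)" if "i < N" for i j
    using that by (auto simp: R_def if_distrib[of "\<lambda>x. x * _"] cong: if_cong)
  then have "mat N N (\<lambda>(i, j). if i = k then \<Sum>l<N. h l * T l j else T i j)
     = mat N N (\<lambda>(i, j). \<Sum>l<N. R i l * T l j)"
    by (intro eq_matI) auto
  then have "array_det N (\<lambda>i j. if i = k then \<Sum>l<N. h l * T l j else T i j)
      = array_det N R * array_det N T"
    using array_det_mult[of N R T] by (simp add: array_det_def)
  moreover have "array_det N R = h k"
  proof -
    \<comment> \<open>Only the identity contributes: a nonzero product forces \<open>p\<close> to
      fix every row other than \<open>k\<close>, and then \<open>k\<close> as well by
      injectivity.\<close>
    have "(\<Prod>i<N. R i (p i)) = 0" if p: "p permutes {..<N}" and "p \<noteq> id" for p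
    proof (rule ccontr)
      assume nz: "(\<Prod>i<N. R i (p i)) \<noteq> 0"
      have ne: "p i = i" if "i < N" "i \<noteq> k" for i
      proof -
        have "R i (p i) \<noteq> 0" using nz that by (simp add: prod_zero_iff)
        then show ?thesis using that by (simp add: R_def split: if_splits)
      qed
      have "p k = k"
      proof (rule ccontr)
        assume "p k \<noteq> k"
        moreover have "p k < N" using p k by (metis lessThan_iff permutes_in_image)
        ultimately have "p (p k) = p k" by (intro ne)
        then show False using \<open>p k \<noteq> k\<close> permutes_inj[OF p] by (metis injD)
      qed
      then have "p i = i" for i
        using ne p by (cases "i < N") (auto simp: permutes_def)
      then show False using \<open>p \<noteq> id\<close> by auto
    qed
    then have "array_det N R = (\<Sum>p\<in>{id}. signof p * (\<Prod>i<N. R i (p i)))"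
      unfolding array_det_leibniz
      by (intro sum.mono_neutral_right) (auto simp: finite_permutations permutes_id)
    also have "\<dots> = (\<Prod>i<N. R i i)" by simp
    also have "\<dots> = R k k * (\<Prod>i\<in>{..<N} - {k}. R i i)" using k by (intro prod.remove) auto
    also have "\<dots> = h k" by (simp add: R_def prod.neutral)
    finally show ?thesis .
  qed
  ultimately show ?thesis by simp
qed

text \<open>This allows a linear functional of a vector to be rewritten as a functional of its image
  under the invertible \<open>T\<close>.\<close>

lemma array_det_solve_transpose:
  assumes "array_det N T \<noteq> 0"
  obtains h where "\<And>j. j < N \<Longrightarrow> (\<Sum>i<N. h i * T i j) = g j"
proof -
  let ?A = "mat N N (\<lambda>(i, j). T j i)"
  have A: "?A \<in> carrier_mat N N" by simp
  have "det ?A \<noteq> 0"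
    using assms array_det_transpose[of N T] unfolding array_det_def by simp
  from det_non_zero_imp_unit[OF A this, of "()"]
  obtain B where B: "B \<in> carrier_mat N N" "?A * B = 1\<^sub>m N"
    unfolding Units_def by (auto simp: ring_mat_simps)
  define h where "h = B *\<^sub>v vec N g"
  have h: "h \<in> carrier_vec N" using B by (simp add: h_def)
  have "?A *\<^sub>v h = (?A * B) *\<^sub>v vec N g"
    unfolding h_def using A B(1) by (intro assoc_mult_mat_vec[symmetric, where n\<^sub>3 = N]) auto
  then have eq: "?A *\<^sub>v h = vec N g" using B(2) by simp
  show thesis
  proof (rule that[of "vec_index h"])
    fix j assume j: "j < N"
    have "(\<Sum>i<N. vec_index h i * T i j) = vec_index (?A *\<^sub>v h) j"
      using j h by (simp add: scalar_prod_def atLeast0LessThan mult.commute)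
    then show "(\<Sum>i<N. vec_index h i * T i j) = g j" using j eq by simp
  qed
qed

text \<open>The functionals \<open>G i\<close> vanish on the vectors chosen before step \<open>i\<close>, which makes the
  matrix of pairings triangular.\<close>

lemma spanning_points_basis:
  fixes \<phi> :: "'x \<Rightarrow> nat \<Rightarrow> real"
  assumes span: "\<And>g. \<exists>i<N. g i \<noteq> 0 \<Longrightarrow> \<exists>y\<in>Y. (\<Sum>i<N. g i * \<phi> y i) \<noteq> 0"
  obtains e where "inj_on e {..<N}" "e ` {..<N} \<subseteq> Y" "array_det N (\<lambda>i. \<phi> (e i)) \<noteq> 0"
proof -
  have "\<exists>e G. \<forall>i<k. e i \<in> Y \<and> (\<Sum>l<N. G i l * \<phi> (e i) l) \<noteq> 0
      \<and> (\<forall>j<i. (\<Sum>l<N. G i l * \<phi> (e j) l) = 0)" if "k \<le> N" for k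
    using that
  proof (induction k)
    case (Suc k)
    then obtain e G where eG: "\<forall>i<k. e i \<in> Y \<and> (\<Sum>l<N. G i l * \<phi> (e i) l) \<noteq> 0
      \<and> (\<forall>j<i. (\<Sum>l<N. G i l * \<phi> (e j) l) = 0)" by auto
    \<comment> \<open>Padding the \<open>k\<close> vectors found so far with zero rows gives a
      singular square array; a kernel vector is a nonzero functional vanishing on all of them, and
      the spanning hypothesis supplies the next vector.\<close>
    have "array_det N (\<lambda>i j. if i < k then \<phi> (e i) j else 0) = 0"
      using Suc.prems by (intro array_det_zero_row[of k]) auto
    then obtain g where g: "\<exists>i<N. g i \<noteq> 0"
      and g0: "\<And>i. i < N \<Longrightarrow> (\<Sum>j<N. (if i < k then \<phi> (e i) j else 0) * g j) = 0"
      by (rule array_det_zero_kernel) blast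
    obtain y where y: "y \<in> Y" "(\<Sum>i<N. g i * \<phi> y i) \<noteq> 0" using span[OF g] by blast
    have "(\<Sum>l<N. g l * \<phi> (e j) l) = 0" if "j < k" for j
      using g0[of j] that Suc.prems by (simp add: mult.commute)
    then show ?case
      using eG y by (intro exI[of _ "e(k := y)"] exI[of _ "G(k := g)"]) (auto simp: less_Suc_eq)
  qed auto
  from this[OF order.refl] obtain e G where e: "\<And>i. i < N \<Longrightarrow> e i \<in> Y"
    and nz: "\<And>i. i < N \<Longrightarrow> (\<Sum>l<N. G i l * \<phi> (e i) l) \<noteq> 0"
    and z: "\<And>i j. i < N \<Longrightarrow> j < i \<Longrightarrow> (\<Sum>l<N. G i l * \<phi> (e j) l) = 0" by blast
  show thesis
  proof (rule that)
    show "inj_on e {..<N}"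
      using nz z by (intro linorder_inj_onI') (metis lessThan_iff)
    show "e ` {..<N} \<subseteq> Y" using e by auto
    have "array_det N G * array_det N (\<lambda>l j. \<phi> (e j) l) = (\<Prod>i<N. \<Sum>l<N. G i l * \<phi> (e i) l)"
      unfolding array_det_mult[symmetric] by (rule array_det_triangular) (use z in auto)
    moreover have "(\<Prod>i<N. \<Sum>l<N. G i l * \<phi> (e i) l) \<noteq> 0" using nz by simp
    moreover have "array_det N (\<lambda>l j. \<phi> (e j) l) = array_det N (\<lambda>j. \<phi> (e j))"
      by (rule array_det_transpose)
    ultimately show "array_det N (\<lambda>i. \<phi> (e i)) \<noteq> 0" by auto
  qed
qed

section \<open>Nearly isotropic position\<close>

definition sq_norm :: "nat \<Rightarrow> (nat \<Rightarrow> real) \<Rightarrow> real" where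
  "sq_norm N v = (\<Sum>i<N. (v i)\<^sup>2)"

definition apply_array :: "nat \<Rightarrow> (nat \<Rightarrow> nat \<Rightarrow> real) \<Rightarrow> (nat \<Rightarrow> real) \<Rightarrow> nat \<Rightarrow> real" where
  "apply_array N T v i = (\<Sum>j<N. T i j * v j)"

lemma sq_norm_nonneg: "0 \<le> sq_norm N v"
  unfolding sq_norm_def by (intro sum_nonneg) auto

lemma sq_norm_eq_0_iff: "sq_norm N v = 0 \<longleftrightarrow> (\<forall>i<N. v i = 0)"
  unfolding sq_norm_def by (subst sum_nonneg_eq_0_iff) auto

lemma sum_mult_square_le: "(\<Sum>i<N. h i * v i)\<^sup>2 \<le> sq_norm N h * sq_norm N v"
  unfolding sq_norm_def by (rule Cauchy_Schwarz_ineq_sum)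

text \<open>The images of a basis under \<open>T\<close> have determinant
  \<open>array_det N T\<close> times the determinant of the basis, and the Hadamard-type bound
  compares this with their lengths. In logarithmic form the estimate can be summed over disjoint
  bases, with constants independent of \<open>T\<close>.\<close>

lemma basis_images_nonzero_and_log_bound:
  fixes \<phi> :: "'x \<Rightarrow> nat \<Rightarrow> real"
  assumes inj: "inj_on e {..<N}" and det: "array_det N (\<lambda>i. \<phi> (e i)) \<noteq> 0"
    and T: "array_det N T \<noteq> 0"
  shows "\<forall>x\<in>e ` {..<N}. 0 < sq_norm N (apply_array N T (\<phi> x))"
    and "ln ((array_det N T)\<^sup>2) \<le> 2 * ln (fact N) - ln ((array_det N (\<lambda>i. \<phi> (e i)))\<^sup>2)
           + (\<Sum>x\<in>e ` {..<N}. ln (sq_norm N (apply_array N T (\<phi> x))))"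
proof -
  let ?s = "\<lambda>i. sq_norm N (apply_array N T (\<phi> (e i)))"
  let ?D = "array_det N (\<lambda>i. \<phi> (e i))"
  have "array_det N (\<lambda>i. apply_array N T (\<phi> (e i)))
      = array_det N (\<lambda>i j. \<Sum>k<N. \<phi> (e i) k * T j k)"
    unfolding apply_array_def by (simp add: mult.commute)
  also have "\<dots> = ?D * array_det N (\<lambda>k j. T j k)"
    by (rule array_det_mult)
  also have "array_det N (\<lambda>k j. T j k) = array_det N T"
    by (rule array_det_transpose)
  finally have le: "(?D * array_det N T)\<^sup>2 \<le> (fact N)\<^sup>2 * (\<Prod>i<N. ?s i)"
    using array_det_square_le[of N "\<lambda>i. apply_array N T (\<phi> (e i))"]
    unfolding sq_norm_def by simp
  moreover have "0 < (?D * array_det N T)\<^sup>2" using det T by simp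
  ultimately have "(\<Prod>i<N. ?s i) \<noteq> 0" by (metis leD mult_zero_right)
  then have pos: "0 < ?s i" if "i < N" for i
    using that sq_norm_nonneg[of N] by (auto simp: order.strict_iff_order)
  then show "\<forall>x\<in>e ` {..<N}. 0 < sq_norm N (apply_array N T (\<phi> x))" by auto
  have prod_pos: "0 < (\<Prod>i<N. ?s i)" using pos by (intro prod_pos) auto
  have "ln (?D\<^sup>2 * (array_det N T)\<^sup>2) \<le> ln ((fact N)\<^sup>2 * (\<Prod>i<N. ?s i))"
    using le det T prod_pos by (subst ln_le_cancel_iff) (simp_all add: power_mult_distrib)
  also have "\<dots> = 2 * ln (fact N) + (\<Sum>i<N. ln (?s i))"
    using pos[THEN less_imp_neq] prod_pos by (subst ln_prod[symmetric]) (auto simp: ln_mult_pos ln_realpow)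
  also have "(\<Sum>i<N. ln (?s i)) = (\<Sum>x\<in>e ` {..<N}. ln (sq_norm N (apply_array N T (\<phi> x))))"
    using inj by (simp add: sum.reindex)
  finally show "ln ((array_det N T)\<^sup>2) \<le> 2 * ln (fact N) - ln (?D\<^sup>2)
           + (\<Sum>x\<in>e ` {..<N}. ln (sq_norm N (apply_array N T (\<phi> x))))"
    using det T by (simp add: ln_mult_pos)
qed

text \<open>Choose \<open>T\<close> with potential within \<open>m / 2\<close> of the infimum.
  Replacing one row of \<open>T\<close> by a scaled combination with coefficients \<open>h\<close>
  raises the determinant term by at least \<open>m\<close>, so near-minimality forces the sum of
  logarithmic lengths to grow by at least \<open>m / 2\<close>. That growth is controlled by the
  squared components of the normalised images along \<open>h\<close>.\<close>

lemma near_isotropic_position: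
  fixes \<phi> :: "'x \<Rightarrow> nat \<Rightarrow> real"
  assumes "N \<ge> 1" and m: "m > (0::real)"
    and pos: "\<And>T x. array_det N T \<noteq> 0 \<Longrightarrow> x \<in> Y \<Longrightarrow> 0 < sq_norm N (apply_array N T (\<phi> x))"
    and bound: "\<And>T. array_det N T \<noteq> 0 \<Longrightarrow>
      m * ln ((array_det N T)\<^sup>2) \<le> C + (\<Sum>x\<in>Y. ln (sq_norm N (apply_array N T (\<phi> x))))"
  obtains T where "array_det N T \<noteq> 0"
    and "\<And>h. m / (6 * N) * sq_norm N h \<le>
      (\<Sum>x\<in>Y. (\<Sum>i<N. h i * apply_array N T (\<phi> x) i)\<^sup>2 / sq_norm N (apply_array N T (\<phi> x)))"
proof -
  define pot where "pot T = (\<Sum>x\<in>Y. ln (sq_norm N (apply_array N T (\<phi> x))))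
      - m * ln ((array_det N T)\<^sup>2)" for T
  define S where "S = pot ` {T. array_det N T \<noteq> 0}"
  have "array_det N (\<lambda>i j. if i = j then 1 else 0) = 1"
    by (subst array_det_triangular) auto
  then have "S \<noteq> {}" unfolding S_def using zero_neq_one by (metis (mono_tags, lifting) empty_iff image_eqI mem_Collect_eq)
  have bdd: "bdd_below S"
    unfolding S_def pot_def using bound by (intro bdd_belowI2[of _ "- C"]) (auto simp: algebra_simps)
  have "Inf S < Inf S + m / 2" using m by simp
  then obtain T where T: "array_det N T \<noteq> 0" "pot T < Inf S + m / 2"
    using cInf_lessD[OF \<open>S \<noteq> {}\<close>] unfolding S_def by blast
  have opt: "pot T < pot T' + m / 2" if "array_det N T' \<noteq> 0" for T'
    using T(2) cInf_lower[OF _ bdd, of "pot T'"] that unfolding S_def by force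
  show thesis
  proof (rule that[OF T(1)])
    fix h :: "nat \<Rightarrow> real"
    let ?w = "\<lambda>x. apply_array N T (\<phi> x)"
    let ?t = "\<lambda>x. (\<Sum>i<N. h i * ?w x i)\<^sup>2 / sq_norm N (?w x)"
    define H where "H = sq_norm N h"
    show "m / (6 * N) * H \<le> (\<Sum>x\<in>Y. ?t x)"
    proof (cases "H = 0")
      case True
      then show ?thesis by (auto intro!: sum_nonneg divide_nonneg_nonneg sq_norm_nonneg)
    next
      case False
      then have H: "H > 0" using sq_norm_nonneg[of N h] unfolding H_def by simp
      \<comment> \<open>By averaging, some coordinate of \<open>h\<close> carries at least the
        fraction 1/N of the squared length; the row with this index is replaced, so that the
        determinant is multiplied by a large factor.\<close>
      obtain k where k: "k < N" "H \<le> N * (h k)\<^sup>2"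
      proof -
        have "\<exists>k<N. H \<le> N * (h k)\<^sup>2"
        proof (rule ccontr)
          assume "\<not> ?thesis"
          then have "\<And>k. k < N \<Longrightarrow> (h k)\<^sup>2 < H / N" using \<open>N \<ge> 1\<close> by (auto simp: field_simps)
          then have "(\<Sum>k<N. (h k)\<^sup>2) < (\<Sum>k<N. H / N)"
            using \<open>N \<ge> 1\<close> by (intro sum_strict_mono) (auto simp: lessThan_empty_iff)
          then show False using \<open>N \<ge> 1\<close> unfolding H_def sq_norm_def by simp
        qed
        then show thesis using that by blast
      qed
      \<comment> \<open>This scale makes \<open>a * (h k)\<^sup>2\<close> at least 3, hence at least
        exp 1, so the logarithm of the squared determinant gains at least 1.\<close>
      define a where "a = 3 * N / H"
      have a: "a > 0" using H \<open>N \<ge> 1\<close> by (simp add: a_def)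
      define T' where "T' = (\<lambda>i j. if i = k then \<Sum>l<N. (sqrt a * h l) * T l j else T i j)"
      have det': "array_det N T' = sqrt a * h k * array_det N T"
        unfolding T'_def using k(1) by (rule array_det_replace_row)
      have "h k \<noteq> 0" using k(2) H by auto
      then have T': "array_det N T' \<noteq> 0" using det' T(1) a by simp
      have "(array_det N T')\<^sup>2 = a * (h k)\<^sup>2 * (array_det N T)\<^sup>2"
        using a by (simp add: det' power_mult_distrib)
      moreover have "3 \<le> a * (h k)\<^sup>2" using k(2) H by (simp add: a_def field_simps)
      ultimately have "3 * (array_det N T)\<^sup>2 \<le> (array_det N T')\<^sup>2"
        by (simp add: mult_right_mono)
      then have "ln (3 * (array_det N T)\<^sup>2) \<le> ln ((array_det N T')\<^sup>2)"
        using T(1) T' by (subst ln_le_cancel_iff) auto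
      moreover have "1 \<le> ln (3::real)" using exp_le by (simp add: ln_ge_iff)
      ultimately have ln_det: "1 + ln ((array_det N T)\<^sup>2) \<le> ln ((array_det N T')\<^sup>2)"
        using T(1) by (simp add: ln_mult_pos)
      \<comment> \<open>Only entry \<open>k\<close> of the image changes, to \<open>sqrt a\<close>
        times its component along \<open>h\<close>. The squared length thus grows at most by the
        factor \<open>1 + a * ?t x\<close>, and ln (1 + z) \<le> z.\<close>
      have step: "ln (sq_norm N (apply_array N T' (\<phi> x))) \<le> ln (sq_norm N (?w x)) + a * ?t x"
        if x: "x \<in> Y" for x
      proof -
        let ?h = "\<Sum>l<N. h l * ?w x l"
        have row: "apply_array N T' (\<phi> x) i = (if i = k then sqrt a * ?h else ?w x i)" for i
        proof (cases "i = k")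
          case True
          have "(\<Sum>j<N. (\<Sum>l<N. sqrt a * h l * T l j) * \<phi> x j)
              = (\<Sum>j<N. \<Sum>l<N. sqrt a * (h l * (T l j * \<phi> x j)))"
            by (simp add: sum_distrib_right mult.assoc)
          also have "\<dots> = (\<Sum>l<N. \<Sum>j<N. sqrt a * (h l * (T l j * \<phi> x j)))"
            by (rule sum.swap)
          also have "\<dots> = sqrt a * ?h"
            by (simp add: apply_array_def sum_distrib_left)
          finally show ?thesis using True by (simp add: apply_array_def T'_def)
        qed (simp add: apply_array_def T'_def)
        have "sq_norm N (apply_array N T' (\<phi> x)) \<le> (\<Sum>i<N. (?w x i)\<^sup>2 + (if i = k then a * ?h\<^sup>2 else 0))"
          unfolding sq_norm_def using a by (intro sum_mono) (auto simp: row power_mult_distrib)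
        also have "\<dots> = sq_norm N (?w x) + a * ?h\<^sup>2"
          using k(1) by (simp add: sum.distrib sq_norm_def)
        also have "\<dots> = sq_norm N (?w x) * (1 + a * ?t x)"
          using pos[OF T(1) x] by (simp add: field_simps)
        finally have "ln (sq_norm N (apply_array N T' (\<phi> x))) \<le> ln (sq_norm N (?w x) * (1 + a * ?t x))"
          using pos[OF T' x] by simp
        also have "\<dots> = ln (sq_norm N (?w x)) + ln (1 + a * ?t x)"
          using pos[OF T(1) x] a by (intro ln_mult_pos) (auto intro!: add_pos_nonneg)
        also have "ln (1 + a * ?t x) \<le> a * ?t x"
          using a pos[OF T(1) x] by (intro ln_add_one_self_le_self) auto
        finally show ?thesis by simp
      qed
      have "(\<Sum>x\<in>Y. ln (sq_norm N (apply_array N T' (\<phi> x))))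
          \<le> (\<Sum>x\<in>Y. ln (sq_norm N (?w x))) + a * (\<Sum>x\<in>Y. ?t x)"
        unfolding sum_distrib_left sum.distrib[symmetric] by (intro sum_mono step)
      moreover have "m * (1 + ln ((array_det N T)\<^sup>2)) \<le> m * ln ((array_det N T')\<^sup>2)"
        using ln_det m by (intro mult_left_mono) auto
      ultimately have "m / 2 \<le> a * (\<Sum>x\<in>Y. ?t x)"
        using opt[OF T'] unfolding pot_def by (simp add: algebra_simps)
      then show ?thesis using H \<open>N \<ge> 1\<close> by (simp add: a_def field_simps)
    qed
  qed
qed

text \<open>Take a maximal disjoint family of bases. If the uncovered points made up at least half
  of \<open>X\<close>, no hyperplane could contain them all, so they would span and contain one more
  basis. Hence the bases cover more than half of \<open>X\<close>.\<close>

lemma disjoint_bases: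
  fixes \<phi> :: "'x \<Rightarrow> nat \<Rightarrow> real"
  assumes "N \<ge> 1" and fin: "finite X"
    and few: "\<And>g. \<exists>i<N. g i \<noteq> 0 \<Longrightarrow> 2 * card {x\<in>X. (\<Sum>i<N. g i * \<phi> x i) = 0} < card X"
  obtains \<B> where "\<Union>\<B> \<subseteq> X" "disjoint \<B>" "card X \<le> 2 * N * card \<B>"
    "\<And>B. B \<in> \<B> \<Longrightarrow> \<exists>e. inj_on e {..<N} \<and> B = e ` {..<N} \<and> array_det N (\<lambda>i. \<phi> (e i)) \<noteq> 0"
proof -
  define basis where "basis B \<longleftrightarrow>
    (\<exists>e. inj_on e {..<N} \<and> B = e ` {..<N} \<and> array_det N (\<lambda>i. \<phi> (e i)) \<noteq> 0)" for B
  define F where "F = {\<B>. \<Union>\<B> \<subseteq> X \<and> disjoint \<B> \<and> (\<forall>B\<in>\<B>. basis B)}"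
  have "F \<subseteq> Pow (Pow X)" unfolding F_def by auto
  then have "finite F" using fin by (simp add: finite_subset)
  moreover have "{} \<in> F" unfolding F_def by simp
  ultimately obtain \<B> where \<B>: "\<B> \<in> F" and max: "\<And>\<B>'. \<B>' \<in> F \<Longrightarrow> \<B> \<subseteq> \<B>' \<Longrightarrow> \<B>' = \<B>"
    using finite_has_maximal[of F] by (metis empty_iff)
  have sub: "\<Union>\<B> \<subseteq> X" and dis: "disjoint \<B>" and bas: "\<And>B. B \<in> \<B> \<Longrightarrow> basis B"
    using \<B> unfolding F_def by auto
  let ?R = "X - \<Union>\<B>"
  have "2 * card ?R < card X"
  proof (rule ccontr)
    assume R: "\<not> 2 * card ?R < card X"
    have "\<exists>y\<in>?R. (\<Sum>i<N. g i * \<phi> y i) \<noteq> 0" if g: "\<exists>i<N. g i \<noteq> 0" for g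
    proof (rule ccontr)
      assume "\<not> ?thesis"
      then have "card ?R \<le> card {x\<in>X. (\<Sum>i<N. g i * \<phi> x i) = 0}"
        using fin by (intro card_mono) auto
      then show False using few[OF g] R by linarith
    qed
    then obtain e where e: "inj_on e {..<N}" "e ` {..<N} \<subseteq> ?R" "array_det N (\<lambda>i. \<phi> (e i)) \<noteq> 0"
      by (rule spanning_points_basis)
    define B where "B = e ` {..<N}"
    \<comment> \<open>Maximality then puts \<open>B\<close> into the family, although it is nonempty
      (as \<open>N\<close> is positive) and avoids the union of the family.\<close>
    have "insert B \<B> \<in> F"
      using sub dis bas e unfolding F_def
      by (auto simp: B_def basis_def disjoint_def pairwise_def disjnt_def)
    then have "B \<in> \<B>" using max by blast
    moreover have "B \<noteq> {}" using \<open>N \<ge> 1\<close> by (auto simp: B_def lessThan_empty_iff)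
    ultimately show False using e(2) unfolding B_def by blast
  qed
  moreover have "card (\<Union>\<B>) = N * card \<B>"
  proof -
    have "card B = N" if "B \<in> \<B>" for B
      using bas[OF that] unfolding basis_def by (auto simp: card_image)
    then show ?thesis
      using dis by (subst card_Union_disjoint) (auto simp: basis_def dest!: bas)
  qed
  moreover have "card ?R = card X - card (\<Union>\<B>)" "card (\<Union>\<B>) \<le> card X"
    using sub fin by (auto simp: card_Diff_subset finite_subset card_mono)
  ultimately have "card X \<le> 2 * N * card \<B>" by simp
  with sub dis bas show thesis unfolding basis_def by (intro that) auto
qed

section \<open>Cutting by half-spaces\<close>

text \<open>A label class on which \<open>P\<close> takes both values is contained in this set
  entirely, and any other class is disjoint from it.\<close>

definition mixed :: "'x set \<Rightarrow> ('x \<Rightarrow> 'l) \<Rightarrow> ('x \<Rightarrow> bool) \<Rightarrow> 'x set" where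
  "mixed X l P = {x\<in>X. \<exists>y\<in>X. l y = l x \<and> P y \<noteq> P x}"

text \<open>Only the partition induced by a labelling matters. Recoding pairs, options and sets as
  natural numbers keeps all existential statements over a single label type.\<close>

lemma nat_labelling:
  assumes "finite X"
  obtains l' :: "'x \<Rightarrow> nat" where "card (l' ` X) = card (l ` X)"
    and "\<And>x y. x \<in> X \<Longrightarrow> y \<in> X \<Longrightarrow> l' x = l' y \<longleftrightarrow> l x = l y"
proof -
  obtain f :: "_ \<Rightarrow> nat" where f: "inj_on f (l ` X)"
    using assms finite_imp_inj_to_nat_seg[of "l ` X"] by blast
  show thesis
  proof (rule that[of "f \<circ> l"])
    show "card ((f \<circ> l) ` X) = card (l ` X)" by (simp only: image_comp[symmetric] card_image[OF f])
    show "(f \<circ> l) x = (f \<circ> l) y \<longleftrightarrow> l x = l y" if "x \<in> X" "y \<in> X" for x y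
      using f that by (auto simp: inj_on_def)
  qed
qed

lemma mixed_cong_labels:
  assumes "\<And>x y. x \<in> X \<Longrightarrow> y \<in> X \<Longrightarrow> l' x = l' y \<longleftrightarrow> l x = l y"
  shows "mixed X l' P = mixed X l P"
  using assms unfolding mixed_def by blast

text \<open>Disjoint bases cover a set \<open>Y\<close> of at least half of \<open>X\<close> and
  bound the potential from below. In near-isotropic position, round the normalised images of
  \<open>Y\<close> to a grid. For every half-space a fixed fraction of the points lies so far from
  the boundary that equal rounding implies the same side, and only the other points can be
  mixed.\<close>

lemma half_space_labelling_spread:
  fixes \<phi> :: "'x \<Rightarrow> nat \<Rightarrow> real"
  assumes N: "N \<ge> 1" and fin: "finite X"
    and few: "\<And>g. \<exists>i<N. g i \<noteq> 0 \<Longrightarrow> 2 * card {x\<in>X. (\<Sum>i<N. g i * \<phi> x i) = 0} < card X"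
  obtains l :: "'x \<Rightarrow> nat" where "card (l ` X) \<le> (24 * N ^ 3 + 1) ^ N + 1"
    and "\<And>h. card (mixed X l (\<lambda>x. (\<Sum>i<N. h i * \<phi> x i) \<ge> 0)) \<le> (1 - 1 / (24 * real N ^ 2)) * card X"
proof -
  have "\<exists>i<N. (\<lambda>_. 1 :: real) i \<noteq> 0" using N by (intro exI[of _ 0]) auto
  from few[OF this] have X: "card X > 0" by simp
  obtain \<B> where sub: "\<Union>\<B> \<subseteq> X" and dis: "disjoint \<B>" and cX: "card X \<le> 2 * N * card \<B>"
    and bas: "\<And>B. B \<in> \<B> \<Longrightarrow> \<exists>e. inj_on e {..<N} \<and> B = e ` {..<N} \<and> array_det N (\<lambda>i. \<phi> (e i)) \<noteq> 0"
    using disjoint_bases[OF N fin few] by blast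
  define Y where "Y = \<Union>\<B>"
  define m where "m = card \<B>"
  have m: "m > 0" using cX X N unfolding m_def by (cases "card \<B> = 0") auto
  have Y: "Y \<subseteq> X" "finite Y" using sub fin by (auto simp: Y_def finite_subset)
  have finB: "finite B" "card B = N" if "B \<in> \<B>" for B using bas[OF that] by (auto simp: card_image)
  have cY: "card Y = N * m"
    unfolding Y_def m_def using dis finB by (subst card_Union_disjoint) auto
  obtain e where e: "\<And>B. B \<in> \<B> \<Longrightarrow> inj_on (e B) {..<N}" "\<And>B. B \<in> \<B> \<Longrightarrow> B = e B ` {..<N}"
    "\<And>B. B \<in> \<B> \<Longrightarrow> array_det N (\<lambda>i. \<phi> (e B i)) \<noteq> 0"
    using bas by metis
  \<comment> \<open>The constants of the individual bases add up to the constant in the lower bound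
    for the potential; disjointness turns the double sum over bases and their elements into a sum
    over \<open>Y\<close>.\<close>
  define c where "c B = 2 * ln (fact N) - ln ((array_det N (\<lambda>i. \<phi> (e B i)))\<^sup>2)" for B
  have pos: "0 < sq_norm N (apply_array N T (\<phi> x))" if T: "array_det N T \<noteq> 0" and "x \<in> Y" for T x
  proof -
    obtain B where B: "B \<in> \<B>" "x \<in> B" using \<open>x \<in> Y\<close> by (auto simp: Y_def)
    then show ?thesis
      using basis_images_nonzero_and_log_bound(1)[OF e(1,3)[OF B(1)] T] e(2) by blast
  qed
  have bound: "real m * ln ((array_det N T)\<^sup>2)
      \<le> sum c \<B> + (\<Sum>x\<in>Y. ln (sq_norm N (apply_array N T (\<phi> x))))" if T: "array_det N T \<noteq> 0" for T
  proof -
    have "real m * ln ((array_det N T)\<^sup>2) = (\<Sum>B\<in>\<B>. ln ((array_det N T)\<^sup>2))" by (simp add: m_def)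
    also have "\<dots> \<le> (\<Sum>B\<in>\<B>. c B + (\<Sum>x\<in>B. ln (sq_norm N (apply_array N T (\<phi> x)))))"
    proof (rule sum_mono)
      fix B assume B: "B \<in> \<B>"
      show "ln ((array_det N T)\<^sup>2) \<le> c B + (\<Sum>x\<in>B. ln (sq_norm N (apply_array N T (\<phi> x))))"
        using basis_images_nonzero_and_log_bound(2)[OF e(1,3)[OF B] T] e(2)[OF B, symmetric]
        unfolding c_def by simp
    qed
    also have "\<dots> = sum c \<B> + (\<Sum>x\<in>Y. ln (sq_norm N (apply_array N T (\<phi> x))))"
      unfolding Y_def sum.distrib using dis finB
      by (subst sum.Union_disjoint) (auto simp: disjoint_def pairwise_def disjnt_def)
    finally show ?thesis .
  qed
  have "real m > 0" using m by simp
  then obtain T where T: "array_det N T \<noteq> 0"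
    and iso: "\<And>h. real m / (6 * N) * sq_norm N h \<le>
      (\<Sum>x\<in>Y. (\<Sum>i<N. h i * apply_array N T (\<phi> x) i)\<^sup>2 / sq_norm N (apply_array N T (\<phi> x)))"
    by (rule near_isotropic_position[OF N _ pos bound]) (assumption | erule that)+
  \<comment> \<open>The grid has \<open>L\<close> steps per unit. Unit vectors with equal roundings
    are at squared distance at most \<open>N / (real L)\<^sup>2\<close>, which is below the
    threshold \<open>\<eta>\<close> introduced later.\<close>
  define L where "L = 12 * N ^ 3"
  have L: "L > 0" using N by (simp add: L_def)
  define w where "w x = apply_array N T (\<phi> x)" for x
  define u where "u x i = w x i / sqrt (sq_norm N (w x))" for x i
  have w: "0 < sq_norm N (w x)" if "x \<in> Y" for x using pos[OF T that] by (simp add: w_def)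
  have sq_u: "sq_norm N (u x) = 1" if "x \<in> Y" for x
    using w[OF that] by (simp add: u_def sq_norm_def power_divide flip: sum_divide_distrib)
  have abs_u: "\<bar>u x i\<bar> \<le> 1" if "x \<in> Y" "i < N" for x i
  proof -
    have "(u x i)\<^sup>2 \<le> sq_norm N (u x)" unfolding sq_norm_def using that by (intro member_le_sum) auto
    then show ?thesis using sq_u[OF that(1)] by (simp add: abs_square_le_1)
  qed
  \<comment> \<open>All points outside \<open>Y\<close> share the label \<open>None\<close>; on
    \<open>Y\<close> each rounded coordinate takes one of \<open>2 * L + 1\<close> values.\<close>
  define lab where "lab x = (if x \<in> Y then Some (\<lambda>i\<in>{..<N}. \<lfloor>real L * u x i\<rfloor>) else None)" for x
  have "lab ` X \<subseteq> insert None (Some ` ({..<N} \<rightarrow>\<^sub>E {- int L..int L}))"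
  proof (rule image_subsetI)
    fix x assume "x \<in> X"
    have "\<lfloor>real L * u x i\<rfloor> \<in> {- int L..int L}" if x: "x \<in> Y" and "i < N" for i
    proof -
      have "real L * \<bar>u x i\<bar> \<le> real L * 1" using abs_u[OF that] by (intro mult_left_mono) auto
      then have "\<bar>real L * u x i\<bar> \<le> real L" by (simp add: abs_mult)
      then show ?thesis by (auto simp: le_floor_iff floor_le_iff abs_le_iff)
    qed
    then have "(\<lambda>i\<in>{..<N}. \<lfloor>real L * u x i\<rfloor>) \<in> {..<N} \<rightarrow>\<^sub>E {- int L..int L}" if "x \<in> Y"
      using that by (auto simp: PiE_iff)
    then show "lab x \<in> insert None (Some ` ({..<N} \<rightarrow>\<^sub>E {- int L..int L}))"
      by (simp add: lab_def)
  qed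
  then have "card (lab ` X) \<le> card (insert None (Some ` ({..<N} \<rightarrow>\<^sub>E {- int L..int L})))"
    by (intro card_mono) (auto intro!: finite_PiE)
  also have "\<dots> \<le> card (Some ` ({..<N} \<rightarrow>\<^sub>E {- int L..int L})) + 1"
    by (simp add: card_insert_if finite_PiE)
  also have "\<dots> = (24 * N ^ 3 + 1) ^ N + 1"
    by (simp add: card_image card_PiE L_def nat_add_distrib nat_mult_distrib nat_power_eq)
  finally have card_lab: "card (lab ` X) \<le> (24 * N ^ 3 + 1) ^ N + 1" .
  obtain l :: "'x \<Rightarrow> nat" where l: "card (l ` X) = card (lab ` X)"
    "\<And>x y. x \<in> X \<Longrightarrow> y \<in> X \<Longrightarrow> l x = l y \<longleftrightarrow> lab x = lab y"
    using nat_labelling[OF fin] by blast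
  show thesis
  proof (rule that[of l])
    show "card (l ` X) \<le> (24 * N ^ 3 + 1) ^ N + 1" using card_lab l(1) by simp
    fix h :: "nat \<Rightarrow> real"
    let ?P = "\<lambda>x. (\<Sum>i<N. h i * \<phi> x i) \<ge> 0"
    \<comment> \<open>The half-space \<open>h\<close> on the original vectors is the half-space
      \<open>g\<close> on their images under \<open>T\<close>.\<close>
    obtain g where g: "\<And>j. j < N \<Longrightarrow> (\<Sum>i<N. g i * T i j) = h j"
      using array_det_solve_transpose[OF T] by blast
    have hg: "(\<Sum>j<N. h j * \<phi> x j) = (\<Sum>i<N. g i * w x i)" for x
    proof -
      have "(\<Sum>j<N. h j * \<phi> x j) = (\<Sum>j<N. \<Sum>i<N. g i * T i j * \<phi> x j)"
        by (simp add: g[symmetric] sum_distrib_right)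
      also have "\<dots> = (\<Sum>i<N. \<Sum>j<N. g i * T i j * \<phi> x j)" by (rule sum.swap)
      finally show ?thesis by (simp add: w_def apply_array_def sum_distrib_left mult.assoc)
    qed
    define G where "G = sq_norm N g"
    have "real (card (mixed X lab ?P)) \<le> (1 - 1 / (24 * real N ^ 2)) * card X"
    proof (cases "G = 0")
      case True
      then have "(\<Sum>i<N. h i * \<phi> x i) = 0" for x
        unfolding hg by (intro sum.neutral) (simp add: G_def sq_norm_eq_0_iff)
      then have "mixed X lab ?P = {}" by (simp add: mixed_def)
      moreover have "1 \<le> 24 * real N ^ 2" using one_le_power[of "real N" 2] N by linarith
      ultimately show ?thesis by (auto intro!: mult_nonneg_nonneg simp: divide_le_eq)
    next
      case False
      then have G: "G > 0" using sq_norm_nonneg[of N g] by (simp add: G_def)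
      define t where "t x = (\<Sum>i<N. g i * u x i)" for x
      have gw: "(\<Sum>i<N. g i * w x i) = sqrt (sq_norm N (w x)) * t x" if "x \<in> Y" for x
        using w[OF that] by (simp add: t_def u_def sum_distrib_left)
      have Pt: "?P x \<longleftrightarrow> t x \<ge> 0" if "x \<in> Y" for x
        using w[OF that] by (simp add: hg gw[OF that] zero_le_mult_iff)
      have t2: "(t x)\<^sup>2 = (\<Sum>i<N. g i * w x i)\<^sup>2 / sq_norm N (w x)" if "x \<in> Y" for x
        using w[OF that] by (simp add: gw[OF that] power_mult_distrib)
      \<comment> \<open>Half of the average guaranteed by isotropy. Points of \<open>Y\<close> below
        \<open>\<eta> * G\<close> account for at most half of the sum of squares, and every other
        point contributes at most \<open>G\<close>, so at least \<open>m / (12 * N)\<close> points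
        are in \<open>big\<close>.\<close>
      define \<eta> where "\<eta> = 1 / (12 * real N ^ 2)"
      define big where "big = {x\<in>Y. \<eta> * G \<le> (t x)\<^sup>2}"
      have "real m / (6 * N) * G \<le> (\<Sum>x\<in>Y. (t x)\<^sup>2)"
        using iso[of g] t2 by (simp add: G_def w_def)
      also have "\<dots> \<le> (\<Sum>x\<in>Y. (if x \<in> big then G else 0) + \<eta> * G)"
      proof (rule sum_mono)
        fix x assume x: "x \<in> Y"
        have "(t x)\<^sup>2 \<le> G"
          using sum_mult_square_le[of g "u x" N] sq_u[OF x] by (simp add: t_def G_def)
        moreover have "0 \<le> \<eta> * G" using G by (simp add: \<eta>_def)
        ultimately show "(t x)\<^sup>2 \<le> (if x \<in> big then G else 0) + \<eta> * G"
          using x by (auto simp: big_def)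
      qed
      also have "\<dots> = (card big + \<eta> * (N * m)) * G"
      proof -
        have "(\<Sum>x\<in>Y. if x \<in> big then G else 0) = (\<Sum>x\<in>big. G)"
          using Y by (intro sum.mono_neutral_cong_right) (auto simp: big_def)
        then show ?thesis by (simp add: sum.distrib cY algebra_simps)
      qed
      finally have "real m / (6 * N) \<le> card big + \<eta> * (N * m)"
        using G by (rule mult_right_le_imp_le)
      moreover have "\<eta> * (N * m) = real m / (12 * N)" using N by (simp add: \<eta>_def power2_eq_square)
      moreover have "real m / (6 * N) = real m / (12 * N) + real m / (12 * N)" by simp
      ultimately have "real m / (12 * N) \<le> card big" by linarith
      moreover have "card X / (24 * real N ^ 2) \<le> real m / (12 * N)"
      proof -
        have "real (card X) \<le> 2 * real N * real m" using cX unfolding m_def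
          by (metis of_nat_le_iff of_nat_mult of_nat_numeral)
        then have "card X / (24 * real N ^ 2) \<le> (2 * real N * real m) / (24 * real N ^ 2)"
          by (intro divide_right_mono) auto
        then show ?thesis using N by (simp add: power2_eq_square field_simps)
      qed
      ultimately have big: "card X / (24 * real N ^ 2) \<le> card big" by linarith
      \<comment> \<open>Within the cell of a point \<open>x\<close> of \<open>big\<close>,
        Cauchy-Schwarz shows that \<open>t\<close> changes by less than the absolute value of
        \<open>t x\<close>, so its sign stays the same.\<close>
      have "big \<inter> mixed X lab ?P = {}"
      proof (rule ccontr)
        assume "\<not> ?thesis"
        then obtain x y where x: "x \<in> big" and y: "y \<in> X" "lab y = lab x" "?P y \<noteq> ?P x"
          by (auto simp: mixed_def)
        have xY: "x \<in> Y" using x by (simp add: big_def)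
        then have yY: "y \<in> Y" using y(2) by (auto simp: lab_def split: if_splits)
        have diff: "(u x i - u y i)\<^sup>2 \<le> 1 / (real L)\<^sup>2" if i: "i < N" for i
        proof -
          have "(\<lambda>i\<in>{..<N}. \<lfloor>real L * u y i\<rfloor>) = (\<lambda>i\<in>{..<N}. \<lfloor>real L * u x i\<rfloor>)"
            using y(2) xY yY by (simp add: lab_def)
          from fun_cong[OF this, of i] have "\<lfloor>real L * u y i\<rfloor> = \<lfloor>real L * u x i\<rfloor>" using i by simp
          then have "\<bar>real L * u x i - real L * u y i\<bar> \<le> 1" by linarith
          then have "\<bar>real L * (u x i - u y i)\<bar> \<le> 1" by (simp add: algebra_simps)
          then have "(u x i - u y i)\<^sup>2 * (real L)\<^sup>2 \<le> 1"
            by (simp only: abs_square_le_1[symmetric] power_mult_distrib mult.commute)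
          then show ?thesis using L by (simp add: pos_le_divide_eq)
        qed
        have "(t x - t y)\<^sup>2 = (\<Sum>i<N. g i * (u x i - u y i))\<^sup>2"
          by (simp add: t_def sum_subtractf algebra_simps)
        also have "\<dots> \<le> G * sq_norm N (\<lambda>i. u x i - u y i)"
          unfolding G_def by (rule sum_mult_square_le)
        also have "\<dots> \<le> G * (\<Sum>i<N. 1 / (real L)\<^sup>2)"
          unfolding sq_norm_def using G diff by (intro mult_left_mono sum_mono) auto
        also have "\<dots> = G * (N / (real L)\<^sup>2)" by simp
        also have "\<dots> < G * \<eta>"
        proof (rule mult_strict_left_mono[OF _ G])
          have "N / (real L)\<^sup>2 = 1 / (144 * real N ^ 5)"
            using N by (simp add: L_def field_simps eval_nat_numeral)
          moreover have "12 * real N ^ 2 < 144 * real N ^ 5"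
          proof -
            have "real N ^ 2 \<le> real N ^ 5" using N by (intro power_increasing) auto
            moreover have "0 < real N ^ 5" using N by simp
            ultimately show ?thesis by linarith
          qed
          ultimately show "N / (real L)\<^sup>2 < \<eta>"
            unfolding \<eta>_def using N by (simp add: frac_less2)
        qed
        also have "\<dots> \<le> (t x)\<^sup>2" using x by (simp add: big_def mult.commute)
        finally have "\<bar>t x - t y\<bar> < \<bar>t x\<bar>" using abs_le_square_iff[of "t x" "t x - t y"] by linarith
        then have "(t y \<ge> 0) = (t x \<ge> 0)" by linarith
        then show False using y(3) Pt[OF xY] Pt[OF yY] by blast
      qed
      moreover have "big \<subseteq> X" "mixed X lab ?P \<subseteq> X" using Y by (auto simp: big_def mixed_def)
      ultimately have "card big + card (mixed X lab ?P) \<le> card X"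
        using fin by (subst card_Un_disjoint[symmetric]) (auto intro: card_mono finite_subset)
      then have "card (mixed X lab ?P) \<le> real (card X) - card big" by linarith
      also have "\<dots> \<le> (1 - 1 / (24 * real N ^ 2)) * card X" using big by (simp add: algebra_simps)
      finally show ?thesis .
    qed
    then show "card (mixed X l ?P) \<le> (1 - 1 / (24 * real N ^ 2)) * card X"
      using mixed_cong_labels[of X l lab ?P] l(2) by simp
  qed
qed

text \<open>Induction on the number of coordinates. If a nonzero functional vanishes on at least
  half of the vectors, these live in one dimension less and the induction hypothesis labels them,
  the remaining points getting one extra label. Otherwise the vectors are spread out and can be
  labelled directly.\<close>

lemma half_space_labelling:
  "\<exists>(K::nat) (\<theta>::real). 0 \<le> \<theta> \<and> \<theta> < 1 \<and> (\<forall>(\<phi> :: 'x \<Rightarrow> nat \<Rightarrow> real) X. finite X \<longrightarrow>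
     (\<exists>l :: 'x \<Rightarrow> nat. card (l ` X) \<le> K \<and>
       (\<forall>h. card (mixed X l (\<lambda>x. (\<Sum>i<N. h i * \<phi> x i) \<ge> 0)) \<le> \<theta> * card X)))"
proof (induction N)
  case 0
  have "\<exists>l :: 'x \<Rightarrow> nat. card (l ` X) \<le> 1 \<and>
      (\<forall>h. real (card (mixed X l (\<lambda>x. (\<Sum>i<0. h i * \<phi> x i) \<ge> 0))) \<le> 0 * real (card X))"
    for \<phi> :: "'x \<Rightarrow> nat \<Rightarrow> real" and X
  proof (intro exI[of _ "\<lambda>_. 0"] conjI)
    have "(\<lambda>_. 0::nat) ` X \<subseteq> {0}" by auto
    from card_mono[OF _ this] show "card ((\<lambda>_. 0::nat) ` X) \<le> 1" by simp
  qed (simp add: mixed_def)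
  then show ?case by (intro exI[of _ "1::nat"] exI[of _ "0::real"] conjI order.refl) (simp, blast)
next
  case (Suc N)
  then obtain K :: nat and \<theta> :: real where \<theta>: "0 \<le> \<theta>" "\<theta> < 1"
    and IH: "\<And>(\<phi> :: 'x \<Rightarrow> nat \<Rightarrow> real) X. finite X \<Longrightarrow> \<exists>l :: 'x \<Rightarrow> nat. card (l ` X) \<le> K \<and>
       (\<forall>h. card (mixed X l (\<lambda>x. (\<Sum>i<N. h i * \<phi> x i) \<ge> 0)) \<le> \<theta> * card X)"
    by blast
  \<comment> \<open>The first entry serves the hyperplane case, where a fraction
    \<open>1 - \<theta>\<close> of at least half of the points is unmixed; the second is the bound
    of the spread case.\<close>
  define \<theta>' where "\<theta>' = max ((1 + \<theta>) / 2) (1 - 1 / (24 * real (Suc N) ^ 2))"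
  define K' where "K' = max (K + 1) ((24 * Suc N ^ 3 + 1) ^ Suc N + 1)"
  have main: "\<exists>l :: 'x \<Rightarrow> nat. card (l ` X) \<le> K' \<and>
       (\<forall>h. card (mixed X l (\<lambda>x. (\<Sum>i<Suc N. h i * \<phi> x i) \<ge> 0)) \<le> \<theta>' * card X)"
    if fin: "finite X" for \<phi> :: "'x \<Rightarrow> nat \<Rightarrow> real" and X
  proof (cases "\<exists>g. (\<exists>i<Suc N. g i \<noteq> 0) \<and> card X \<le> 2 * card {x\<in>X. (\<Sum>i<Suc N. g i * \<phi> x i) = 0}")
    case True
    then obtain g k where k: "k < Suc N" "g k \<noteq> 0"
      and many: "card X \<le> 2 * card {x\<in>X. (\<Sum>i<Suc N. g i * \<phi> x i) = 0}"
      by blast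
    define X0 where "X0 = {x\<in>X. (\<Sum>i<Suc N. g i * \<phi> x i) = 0}"
    have X0: "X0 \<subseteq> X" "finite X0" using fin by (auto simp: X0_def)
    \<comment> \<open>Swapping the pivot \<open>k\<close> with the last index makes dropping the
      last coordinate the same as eliminating the pivot.\<close>
    let ?\<sigma> = "Transposition.transpose k N"
    have perm: "?\<sigma> permutes {..<Suc N}" using k(1) by (intro permutes_swap_id) auto
    obtain l0 :: "'x \<Rightarrow> nat" where l0: "card (l0 ` X0) \<le> K"
      "\<And>h. card (mixed X0 l0 (\<lambda>x. (\<Sum>i<N. h i * \<phi> x (?\<sigma> i)) \<ge> 0)) \<le> \<theta> * card X0"
      using IH[OF X0(2), of "\<lambda>x i. \<phi> x (?\<sigma> i)"] by blast
    define l where "l x = (if x \<in> X0 then Suc (l0 x) else 0)" for x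
    have "l ` X \<subseteq> insert 0 (Suc ` l0 ` X0)" by (auto simp: l_def)
    then have "card (l ` X) \<le> card (insert 0 (Suc ` l0 ` X0))" using X0 by (intro card_mono) auto
    also have "\<dots> \<le> K + 1" using X0 l0(1) by (simp add: card_insert_if card_image)
    finally have "card (l ` X) \<le> K'" by (simp add: K'_def)
    moreover have "card (mixed X l (\<lambda>x. (\<Sum>i<Suc N. h i * \<phi> x i) \<ge> 0)) \<le> \<theta>' * card X" for h
    proof -
      let ?P = "\<lambda>x. (\<Sum>i<Suc N. h i * \<phi> x i) \<ge> 0"
      \<comment> \<open>Subtracting this multiple of \<open>g\<close> kills coefficient
        \<open>k\<close> without changing any value on \<open>X0\<close>.\<close>
      define c where "c i = h i - h k / g k * g i" for i
      have restr: "(\<Sum>i<Suc N. h i * \<phi> x i) = (\<Sum>i<N. c (?\<sigma> i) * \<phi> x (?\<sigma> i))" if "x \<in> X0" for x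
      proof -
        have "(\<Sum>i<Suc N. c i * \<phi> x i) = (\<Sum>i<Suc N. h i * \<phi> x i) - h k / g k * (\<Sum>i<Suc N. g i * \<phi> x i)"
          unfolding sum_distrib_left sum_subtractf[symmetric] by (simp add: c_def algebra_simps)
        moreover have "(\<Sum>i<Suc N. g i * \<phi> x i) = 0" using that by (simp add: X0_def)
        moreover have "(\<Sum>i<Suc N. c i * \<phi> x i) = (\<Sum>i<Suc N. c (?\<sigma> i) * \<phi> x (?\<sigma> i))"
          using sum.permute[OF perm, of "\<lambda>i. c i * \<phi> x i"] by (simp add: o_def)
        moreover have "c (?\<sigma> N) = 0" using k(2) by (simp add: c_def)
        ultimately show ?thesis by simp
      qed
      have "mixed X l ?P \<subseteq> (X - X0) \<union> mixed X0 l0 (\<lambda>x. (\<Sum>i<N. c (?\<sigma> i) * \<phi> x (?\<sigma> i)) \<ge> 0)"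
      proof
        fix x assume "x \<in> mixed X l ?P"
        then obtain y where x: "x \<in> X" and y: "y \<in> X" "l y = l x" "?P y \<noteq> ?P x" by (auto simp: mixed_def)
        show "x \<in> (X - X0) \<union> mixed X0 l0 (\<lambda>x. (\<Sum>i<N. c (?\<sigma> i) * \<phi> x (?\<sigma> i)) \<ge> 0)"
        proof (cases "x \<in> X0")
          case True
          then have "y \<in> X0" "l0 y = l0 x" using y(2) by (auto simp: l_def split: if_splits)
          then show ?thesis using True y(3) unfolding mixed_def by (simp only: restr) blast
        qed (use x in auto)
      qed
      then have "card (mixed X l ?P) \<le> card (X - X0) + card (mixed X0 l0 (\<lambda>x. (\<Sum>i<N. c (?\<sigma> i) * \<phi> x (?\<sigma> i)) \<ge> 0))"
        using fin X0 by (intro order.trans[OF card_mono card_Un_le]) (auto simp: mixed_def)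
      also have "real \<dots> \<le> card (X - X0) + \<theta> * card X0"
        using l0(2)[of "c \<circ> ?\<sigma>"] by simp
      also have "\<dots> = real (card X) - (1 - \<theta>) * card X0"
        using X0 fin by (simp add: card_Diff_subset of_nat_diff card_mono algebra_simps)
      also have "\<dots> \<le> real (card X) - (1 - \<theta>) * (card X / 2)"
        using many \<theta> by (intro diff_left_mono mult_left_mono) (auto simp: X0_def)
      also have "\<dots> = (1 + \<theta>) / 2 * card X" by (simp add: field_simps)
      also have "\<dots> \<le> \<theta>' * card X" by (intro mult_right_mono) (auto simp: \<theta>'_def)
      finally show ?thesis by simp
    qed
    ultimately show ?thesis by blast
  next
    case False
    then have few: "\<And>g. \<exists>i<Suc N. g i \<noteq> 0 \<Longrightarrow> 2 * card {x\<in>X. (\<Sum>i<Suc N. g i * \<phi> x i) = 0} < card X"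
      by (meson not_le)
    obtain l :: "'x \<Rightarrow> nat" where l: "card (l ` X) \<le> (24 * Suc N ^ 3 + 1) ^ Suc N + 1"
      "\<And>h. card (mixed X l (\<lambda>x. (\<Sum>i<Suc N. h i * \<phi> x i) \<ge> 0)) \<le> (1 - 1 / (24 * real (Suc N) ^ 2)) * card X"
      by (rule half_space_labelling_spread[of "Suc N", OF _ fin few]) (simp | erule that)+
    have "card (l ` X) \<le> K'" using l(1) unfolding K'_def by linarith
    moreover have "card (mixed X l (\<lambda>x. (\<Sum>i<Suc N. h i * \<phi> x i) \<ge> 0)) \<le> \<theta>' * card X" for h
      using l(2)[of h] by (rule order.trans) (intro mult_right_mono, auto simp: \<theta>'_def)
    ultimately show ?thesis by blast
  qed
  have "0 \<le> \<theta>'" "\<theta>' < 1" using \<theta> by (auto simp: \<theta>'_def le_max_iff_disj)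
  then show ?case by (intro exI[of _ K'] exI[of _ \<theta>'] conjI allI impI main)
qed

section \<open>Cuttings with arbitrarily small mixed fraction\<close>

text \<open>One labelling serves all of \<open>\<H>\<close>, and \<open>K\<close> is uniform over
  the finite sets \<open>X\<close>; the uniformity permits applying the property again inside each
  cell.\<close>

definition cutting :: "('x \<Rightarrow> bool) set \<Rightarrow> real \<Rightarrow> bool" where
  "cutting \<H> \<delta> \<longleftrightarrow> (\<exists>K. \<forall>X. finite X \<longrightarrow>
     (\<exists>l :: 'x \<Rightarrow> nat. card (l ` X) \<le> K \<and> (\<forall>P\<in>\<H>. real (card (mixed X l P)) \<le> \<delta> * real (card X))))"

lemma cutting_mono:
  assumes "cutting \<H> \<delta>" "\<delta> \<le> \<delta>'"
  shows "cutting \<H> \<delta>'"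
proof -
  have "\<delta> * real (card X) \<le> \<delta>' * card X" for X :: "'a set"
    using assms(2) by (intro mult_right_mono) auto
  then show ?thesis using assms(1) unfolding cutting_def by (meson order.trans)
qed

text \<open>Cut every cell of the first labelling again. A point mixed for the refinement lies in a
  cell that was already mixed; these cells hold at most \<open>\<delta> * card X\<close> points
  together, and within each at most the fraction \<open>\<theta>\<close> stays mixed.\<close>

lemma cutting_mult:
  fixes \<H> :: "('x \<Rightarrow> bool) set"
  assumes "cutting \<H> \<delta>" and "cutting \<H> \<theta>" and \<theta>: "0 \<le> \<theta>"
  shows "cutting \<H> (\<theta> * \<delta>)"
proof -
  obtain K1 where K1: "\<And>X. finite X \<Longrightarrow>
     \<exists>l :: 'x \<Rightarrow> nat. card (l ` X) \<le> K1 \<and> (\<forall>P\<in>\<H>. card (mixed X l P) \<le> \<delta> * card X)"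
    using assms(1) unfolding cutting_def by blast
  obtain K2 where K2: "\<And>X. finite X \<Longrightarrow>
     \<exists>l :: 'x \<Rightarrow> nat. card (l ` X) \<le> K2 \<and> (\<forall>P\<in>\<H>. card (mixed X l P) \<le> \<theta> * card X)"
    using assms(2) unfolding cutting_def by blast
  show ?thesis
    unfolding cutting_def
  proof (intro exI[of _ "K1 * K2"] allI impI)
    fix X :: "'x set" assume fin: "finite X"
    obtain l :: "'x \<Rightarrow> nat" where l: "card (l ` X) \<le> K1" "\<And>P. P \<in> \<H> \<Longrightarrow> card (mixed X l P) \<le> \<delta> * card X"
      using K1[OF fin] by blast
    define C where "C a = {x\<in>X. l x = a}" for a
    have finC: "finite (C a)" for a using fin by (simp add: C_def)
    obtain l2 :: "nat \<Rightarrow> 'x \<Rightarrow> nat" where l2: "\<And>a. card (l2 a ` C a) \<le> K2"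
      "\<And>a P. P \<in> \<H> \<Longrightarrow> card (mixed (C a) (l2 a) P) \<le> \<theta> * card (C a)"
      using K2[OF finC] by metis
    define lab where "lab x = (l x, l2 (l x) x)" for x
    have "lab ` X \<subseteq> Sigma (l ` X) (\<lambda>a. l2 a ` C a)" by (auto simp: lab_def C_def)
    then have "card (lab ` X) \<le> card (Sigma (l ` X) (\<lambda>a. l2 a ` C a))"
      using fin finC by (intro card_mono) auto
    also have "\<dots> = (\<Sum>a\<in>l ` X. card (l2 a ` C a))" using fin finC by (intro card_SigmaI) auto
    also have "\<dots> \<le> card (l ` X) * K2" using l2(1) by (intro sum_bounded_above[where K = K2, simplified])
    also have "\<dots> \<le> K1 * K2" using l(1) by simp
    finally have cl: "card (lab ` X) \<le> K1 * K2" .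
    have cm: "card (mixed X lab P) \<le> \<theta> * \<delta> * card X" if P: "P \<in> \<H>" for P
    proof -
      let ?A = "l ` mixed X l P"
      have finm: "finite (mixed X l P)" using fin by (simp add: mixed_def)
      have "mixed X lab P \<subseteq> (\<Union>a\<in>?A. mixed (C a) (l2 a) P)"
        by (fastforce simp: mixed_def lab_def C_def)
      then have "card (mixed X lab P) \<le> (\<Sum>a\<in>?A. card (mixed (C a) (l2 a) P))"
        using finm finC by (intro order.trans[OF card_mono card_UN_le]) (auto simp: mixed_def)
      also have "real \<dots> \<le> (\<Sum>a\<in>?A. \<theta> * card (C a))"
        unfolding of_nat_sum using l2(2)[OF P] by (intro sum_mono)
      also have "\<dots> = \<theta> * card (\<Union>a\<in>?A. C a)"
        using finm finC by (subst card_UN_disjoint) (auto simp: C_def sum_distrib_left)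
      also have "\<dots> \<le> \<theta> * card (mixed X l P)"
      proof -
        have "(\<Union>a\<in>?A. C a) \<subseteq> mixed X l P" by (auto simp: C_def mixed_def; metis)
        then show ?thesis using \<theta> finm by (intro mult_left_mono of_nat_mono card_mono)
      qed
      also have "\<dots> \<le> \<theta> * (\<delta> * card X)" using l(2)[OF P] \<theta> by (intro mult_left_mono)
      finally show ?thesis by simp
    qed
    obtain l' :: "'x \<Rightarrow> nat" where "card (l' ` X) = card (lab ` X)"
      "\<And>x y. x \<in> X \<Longrightarrow> y \<in> X \<Longrightarrow> l' x = l' y \<longleftrightarrow> lab x = lab y"
      using nat_labelling[OF fin] by blast
    then show "\<exists>l :: 'x \<Rightarrow> nat. card (l ` X) \<le> K1 * K2 \<and> (\<forall>P\<in>\<H>. card (mixed X l P) \<le> \<theta> * \<delta> * card X)"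
      using cl cm mixed_cong_labels[of X l' lab] by (intro exI[of _ l']) simp
  qed
qed

lemma cutting_amplify:
  fixes \<H> :: "('x \<Rightarrow> bool) set"
  assumes "cutting \<H> \<theta>" "0 \<le> \<theta>" "\<theta> < 1" "\<delta> > 0"
  shows "cutting \<H> \<delta>"
proof -
  have "cutting \<H> (\<theta> ^ Suc n)" for n
    by (induction n) (use assms cutting_mult in auto)
  moreover obtain n where "\<theta> ^ n < \<delta>" using real_arch_pow_inv[OF assms(4,3)] by blast
  moreover have "\<theta> ^ Suc n \<le> \<theta> ^ n" using assms by (intro power_decreasing) auto
  ultimately show ?thesis by (meson cutting_mono less_imp_le order.trans)
qed

section \<open>Regular relations\<close>

text \<open>A single pair outside \<open>Bad\<close> makes the whole product of its two classes
  homogeneous; this is what later allows a clique of representatives to be blown up.\<close>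

definition homogeneous_off ::
  "('x \<times> 'x) set \<Rightarrow> 'x set \<Rightarrow> ('x \<Rightarrow> 'l) \<Rightarrow> ('x \<Rightarrow> 'x \<Rightarrow> bool) \<Rightarrow> bool" where
  "homogeneous_off Bad P l R \<longleftrightarrow> (\<forall>p\<in>P. \<forall>q\<in>P. \<forall>p'\<in>P. \<forall>q'\<in>P.
     (p, q) \<notin> Bad \<longrightarrow> l p' = l p \<longrightarrow> l q' = l q \<longrightarrow> R p' q' = R p q)"

text \<open>A regularity property with exact homogeneity in place of approximate uniformity:
  boundedly many parts, and all but a fraction \<delta> of the pairs in homogeneous pairs of
  parts.\<close>

definition regular_relation :: "('x \<Rightarrow> 'x \<Rightarrow> bool) \<Rightarrow> bool" where
  "regular_relation R \<longleftrightarrow> (\<forall>\<delta>::real. \<delta> > 0 \<longrightarrow> (\<exists>K::nat. \<forall>P. finite P \<longrightarrow>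
     (\<exists>(l :: 'x \<Rightarrow> nat) Bad. card (l ` P) \<le> K \<and> Bad \<subseteq> P \<times> P \<and>
        real (card Bad) \<le> \<delta> * (real (card P))\<^sup>2 \<and> homogeneous_off Bad P l R)))"

lemma homogeneous_offD:
  assumes "homogeneous_off Bad P l R" "p \<in> P" "q \<in> P" "p' \<in> P" "q' \<in> P" "(p, q) \<notin> Bad"
    "l p' = l p" "l q' = l q"
  shows "R p' q' = R p q"
  using assms unfolding homogeneous_off_def by blast

lemma homogeneous_off_cong_labels:
  assumes "\<And>x y. x \<in> P \<Longrightarrow> y \<in> P \<Longrightarrow> l' x = l' y \<longleftrightarrow> l x = l y"
  shows "homogeneous_off Bad P l' R \<longleftrightarrow> homogeneous_off Bad P l R"
  using assms unfolding homogeneous_off_def by (simp cong: ball_cong)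

text \<open>Refine the cell of a point by recording on which cells its relation, as second argument,
  is constantly true and on which constantly false. A pair fails only if the cell of its first point
  is mixed for its second point.\<close>

lemma regular_relation_of_cutting:
  fixes R :: "'x \<Rightarrow> 'x \<Rightarrow> bool"
  assumes "\<And>\<delta>. \<delta> > 0 \<Longrightarrow> cutting (range (\<lambda>q p. R p q)) \<delta>"
  shows "regular_relation R"
  unfolding regular_relation_def
proof (intro allI impI)
  fix \<delta> :: real assume "\<delta> > 0"
  then obtain K where K: "\<And>P. finite P \<Longrightarrow> \<exists>l :: 'x \<Rightarrow> nat. card (l ` P) \<le> K \<and>
      (\<forall>q. real (card (mixed P l (\<lambda>p. R p q))) \<le> \<delta> * real (card P))"
    using assms unfolding cutting_def by (metis rangeI)
  have "\<exists>(l :: 'x \<Rightarrow> nat) Bad. card (l ` P) \<le> K * (2 ^ K * 2 ^ K) \<and> Bad \<subseteq> P \<times> P \<and>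
      real (card Bad) \<le> \<delta> * (real (card P))\<^sup>2 \<and> homogeneous_off Bad P l R"
    if fin: "finite P" for P
  proof -
    obtain l :: "'x \<Rightarrow> nat" where l: "card (l ` P) \<le> K"
      "\<And>q. real (card (mixed P l (\<lambda>p. R p q))) \<le> \<delta> * real (card P)"
      using K[OF fin] by blast
    define yes where "yes q = {a\<in>l ` P. \<forall>p\<in>P. l p = a \<longrightarrow> R p q}" for q
    define no where "no q = {a\<in>l ` P. \<forall>p\<in>P. l p = a \<longrightarrow> \<not> R p q}" for q
    define lab where "lab p = (l p, yes p, no p)" for p
    have "lab ` P \<subseteq> l ` P \<times> Pow (l ` P) \<times> Pow (l ` P)" by (auto simp: lab_def yes_def no_def)
    then have "card (lab ` P) \<le> card (l ` P \<times> Pow (l ` P) \<times> Pow (l ` P))"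
      using fin by (intro card_mono) auto
    also have "\<dots> = card (l ` P) * (2 ^ card (l ` P) * 2 ^ card (l ` P))"
      using fin by (simp add: card_cartesian_product card_Pow)
    also have "\<dots> \<le> K * (2 ^ K * 2 ^ K)"
      using l(1) by (intro mult_mono power_increasing) auto
    finally have card_lab: "card (lab ` P) \<le> K * (2 ^ K * 2 ^ K)" .
    \<comment> \<open>The count runs over second points, each contributing at most
      \<open>\<delta> * card P\<close> mixed first points; the converse restores the order of the
      pairs.\<close>
    define Bad where "Bad = (SIGMA q:P. mixed P l (\<lambda>p. R p q))\<inverse>"
    have "card Bad = (\<Sum>q\<in>P. card (mixed P l (\<lambda>p. R p q)))"
      unfolding Bad_def card_inverse using fin by (intro card_SigmaI) (auto simp: mixed_def)
    also have "real \<dots> \<le> (\<Sum>q\<in>P. \<delta> * real (card P))"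
      unfolding of_nat_sum by (intro sum_mono l(2))
    finally have card_Bad: "real (card Bad) \<le> \<delta> * (real (card P))\<^sup>2"
      by (simp add: power2_eq_square mult_ac)
    have hom: "homogeneous_off Bad P lab R"
      unfolding homogeneous_off_def
    proof (intro ballI impI)
      fix p q p' q'
      assume p: "p \<in> P" and q: "q \<in> P" and p': "p' \<in> P" and "q' \<in> P" and good: "(p, q) \<notin> Bad"
        and labs: "lab p' = lab p" "lab q' = lab q"
      have const: "R y q = R p q" if "y \<in> P" "l y = l p" for y
        using good p q that unfolding Bad_def mixed_def by blast
      have same: "l p' = l p" "yes q' = yes q" "no q' = no q" using labs by (auto simp: lab_def)
      show "R p' q' = R p q"
      proof (cases "R p q")
        case True
        then have "l p \<in> yes q" unfolding yes_def using p const by blast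
        then have "l p' \<in> yes q'" using same by simp
        then show ?thesis using True p' unfolding yes_def by blast
      next
        case False
        then have "l p \<in> no q" unfolding no_def using p const by blast
        then have "l p' \<in> no q'" using same by simp
        then show ?thesis using False p' unfolding no_def by blast
      qed
    qed
    obtain l' :: "'x \<Rightarrow> nat" where l': "card (l' ` P) = card (lab ` P)"
      "\<And>x y. x \<in> P \<Longrightarrow> y \<in> P \<Longrightarrow> l' x = l' y \<longleftrightarrow> lab x = lab y"
      using nat_labelling[OF fin] by blast
    have "Bad \<subseteq> P \<times> P" by (auto simp: Bad_def mixed_def)
    moreover have "homogeneous_off Bad P l' R"
      using hom homogeneous_off_cong_labels[of P l' lab, OF l'(2)] by blast
    ultimately show ?thesis
      using card_lab card_Bad l'(1) by (intro exI[of _ l'] exI[of _ Bad]) simp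
  qed
  then show "\<exists>K::nat. \<forall>P. finite P \<longrightarrow> (\<exists>(l :: 'x \<Rightarrow> nat) Bad. card (l ` P) \<le> K \<and> Bad \<subseteq> P \<times> P \<and>
      real (card Bad) \<le> \<delta> * (real (card P))\<^sup>2 \<and> homogeneous_off Bad P l R)"
    by blast
qed

lemma regular_relation_not:
  assumes "regular_relation R"
  shows "regular_relation (\<lambda>p q. \<not> R p q)"
  using assms unfolding regular_relation_def homogeneous_off_def by simp

text \<open>Take the common refinement and the union of the exceptional sets, each relation being
  allowed half of the error.\<close>

lemma regular_relation_conj:
  fixes R S :: "'x \<Rightarrow> 'x \<Rightarrow> bool"
  assumes R: "regular_relation R" and S: "regular_relation S"
  shows "regular_relation (\<lambda>p q. R p q \<and> S p q)"
  unfolding regular_relation_def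
proof (intro allI impI)
  fix \<delta> :: real assume "\<delta> > 0"
  then have \<delta>: "\<delta> / 2 > 0" by simp
  obtain K1 where K1: "\<And>P. finite P \<Longrightarrow> \<exists>(l :: 'x \<Rightarrow> nat) Bad. card (l ` P) \<le> K1 \<and> Bad \<subseteq> P \<times> P \<and>
        real (card Bad) \<le> \<delta> / 2 * (real (card P))\<^sup>2 \<and> homogeneous_off Bad P l R"
    using R \<delta> unfolding regular_relation_def by blast
  obtain K2 where K2: "\<And>P. finite P \<Longrightarrow> \<exists>(l :: 'x \<Rightarrow> nat) Bad. card (l ` P) \<le> K2 \<and> Bad \<subseteq> P \<times> P \<and>
        real (card Bad) \<le> \<delta> / 2 * (real (card P))\<^sup>2 \<and> homogeneous_off Bad P l S"
    using S \<delta> unfolding regular_relation_def by blast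
  have "\<exists>(l :: 'x \<Rightarrow> nat) Bad. card (l ` P) \<le> K1 * K2 \<and> Bad \<subseteq> P \<times> P \<and>
      real (card Bad) \<le> \<delta> * (real (card P))\<^sup>2 \<and> homogeneous_off Bad P l (\<lambda>p q. R p q \<and> S p q)"
    if fin: "finite P" for P
  proof -
    obtain l1 :: "'x \<Rightarrow> nat" and B1 where 1: "card (l1 ` P) \<le> K1" "B1 \<subseteq> P \<times> P"
        "real (card B1) \<le> \<delta> / 2 * (real (card P))\<^sup>2" "homogeneous_off B1 P l1 R"
      using K1[OF fin] by blast
    obtain l2 :: "'x \<Rightarrow> nat" and B2 where 2: "card (l2 ` P) \<le> K2" "B2 \<subseteq> P \<times> P"
        "real (card B2) \<le> \<delta> / 2 * (real (card P))\<^sup>2" "homogeneous_off B2 P l2 S"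
      using K2[OF fin] by blast
    define lab where "lab p = (l1 p, l2 p)" for p
    have "lab ` P \<subseteq> l1 ` P \<times> l2 ` P" by (auto simp: lab_def)
    then have "card (lab ` P) \<le> card (l1 ` P \<times> l2 ` P)" using fin by (intro card_mono) auto
    also have "\<dots> \<le> K1 * K2" using 1(1) 2(1) by (simp add: card_cartesian_product mult_mono)
    finally have card_lab: "card (lab ` P) \<le> K1 * K2" .
    have "real (card (B1 \<union> B2)) \<le> real (card B1) + real (card B2)"
      using card_Un_le[of B1 B2] by linarith
    then have card_Bad: "real (card (B1 \<union> B2)) \<le> \<delta> * (real (card P))\<^sup>2"
      using 1(3) 2(3) by simp
    have hom: "homogeneous_off (B1 \<union> B2) P lab (\<lambda>p q. R p q \<and> S p q)"
      unfolding homogeneous_off_def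
    proof (intro ballI impI)
      fix p q p' q'
      assume *: "p \<in> P" "q \<in> P" "p' \<in> P" "q' \<in> P"
        and "(p, q) \<notin> B1 \<union> B2" "lab p' = lab p" "lab q' = lab q"
      then show "(R p' q' \<and> S p' q') = (R p q \<and> S p q)"
        using homogeneous_offD[OF 1(4) *] homogeneous_offD[OF 2(4) *] by (simp add: lab_def)
    qed
    obtain l' :: "'x \<Rightarrow> nat" where l': "card (l' ` P) = card (lab ` P)"
      "\<And>x y. x \<in> P \<Longrightarrow> y \<in> P \<Longrightarrow> l' x = l' y \<longleftrightarrow> lab x = lab y"
      using nat_labelling[OF fin] by blast
    have "homogeneous_off (B1 \<union> B2) P l' (\<lambda>p q. R p q \<and> S p q)"
      using hom homogeneous_off_cong_labels[of P l' lab, OF l'(2)] by blast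
    then show ?thesis
      using card_lab card_Bad l'(1) 1(2) 2(2) by (intro exI[of _ l'] exI[of _ "B1 \<union> B2"]) simp
  qed
  then show "\<exists>K::nat. \<forall>P. finite P \<longrightarrow> (\<exists>(l :: 'x \<Rightarrow> nat) Bad. card (l ` P) \<le> K \<and> Bad \<subseteq> P \<times> P \<and>
      real (card Bad) \<le> \<delta> * (real (card P))\<^sup>2 \<and> homogeneous_off Bad P l (\<lambda>p q. R p q \<and> S p q))"
    by blast
qed

section \<open>Regularity of semi-algebraic relations\<close>

lemma regular_relation_bilinear:
  fixes \<phi> h :: "'x \<Rightarrow> nat \<Rightarrow> real"
  shows "regular_relation (\<lambda>p q. (\<Sum>i<N. h q i * \<phi> p i) \<ge> 0)"
proof (rule regular_relation_of_cutting)
  fix \<delta> :: real assume \<delta>: "\<delta> > 0"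
  obtain K :: nat and \<theta> :: real where \<theta>: "0 \<le> \<theta>" "\<theta> < 1"
    and K: "\<And>(\<phi> :: 'x \<Rightarrow> nat \<Rightarrow> real) X. finite X \<Longrightarrow> \<exists>l :: 'x \<Rightarrow> nat. card (l ` X) \<le> K \<and>
       (\<forall>h. card (mixed X l (\<lambda>x. (\<Sum>i<N. h i * \<phi> x i) \<ge> 0)) \<le> \<theta> * card X)"
    using half_space_labelling[of N] by blast
  have "cutting (range (\<lambda>q p. (\<Sum>i<N. h q i * \<phi> p i) \<ge> 0)) \<theta>"
    unfolding cutting_def using K[of _ \<phi>] by (intro exI[of _ K]) blast
  then show "cutting (range (\<lambda>q p. (\<Sum>i<N. h q i * \<phi> p i) \<ge> 0)) \<delta>"
    using \<theta> \<delta> by (rule cutting_amplify)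
qed

text \<open>Linearisation by monomials: each monomial splits into a factor in the coordinates of
  \<open>p\<close> and one in those of \<open>q\<close>, the coefficient going with
  \<open>q\<close>. For fixed \<open>q\<close> a polynomial inequality thus becomes a half-space in
  the vector \<open>\<phi> p\<close>.\<close>

lemma eval_pair_bilinear:
  fixes f :: "('n::finite + 'n) real_mpoly"
  shows "\<exists>N (\<phi> :: real ^ 'n \<Rightarrow> nat \<Rightarrow> real) h. \<forall>p q. eval_pair f p q = (\<Sum>i<N. h q i * \<phi> p i)"
proof -
  define a where "a m p = (\<Prod>v\<in>Poly_Mapping.keys m.
      case v of Inl i \<Rightarrow> vec_nth p i ^ Poly_Mapping.lookup m v | Inr _ \<Rightarrow> 1)"
    for m :: "('n + 'n) \<Rightarrow>\<^sub>0 nat" and p :: "real ^ 'n"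
  define b where "b m q = Poly_Mapping.lookup f m * (\<Prod>v\<in>Poly_Mapping.keys m.
      case v of Inl _ \<Rightarrow> 1 | Inr j \<Rightarrow> vec_nth q j ^ Poly_Mapping.lookup m v)"
    for m and q :: "real ^ 'n"
  obtain e where e: "bij_betw e {..<card (Poly_Mapping.keys f)} (Poly_Mapping.keys f)"
    using ex_bij_betw_nat_finite[of "Poly_Mapping.keys f"] by (auto simp: atLeast0LessThan)
  have "eval_pair f p q = (\<Sum>i<card (Poly_Mapping.keys f). b (e i) q * a (e i) p)" for p q
  proof -
    have "Poly_Mapping.lookup f m * (\<Prod>v\<in>Poly_Mapping.keys m.
        case_sum (vec_nth p) (vec_nth q) v ^ Poly_Mapping.lookup m v) = b m q * a m p" for m
      unfolding a_def b_def mult.assoc prod.distrib[symmetric]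
      by (intro arg_cong2[where f = "(*)"] refl prod.cong) (auto split: sum.splits)
    then have "eval_pair f p q = (\<Sum>m\<in>Poly_Mapping.keys f. b m q * a m p)"
      unfolding eval_pair_def eval_mpoly_def by simp
    also have "\<dots> = (\<Sum>i<card (Poly_Mapping.keys f). b (e i) q * a (e i) p)"
      by (rule sum.reindex_bij_betw[OF e, symmetric])
    finally show ?thesis .
  qed
  then show ?thesis
    by (intro exI[of _ "card (Poly_Mapping.keys f)"] exI[of _ "\<lambda>p i. a (e i) p"]
        exI[of _ "\<lambda>q i. b (e i) q"]) blast
qed

lemma regular_relation_sa_holds:
  fixes f :: "'j \<Rightarrow> ('n::finite + 'n) real_mpoly"
  shows "regular_relation (sa_holds f \<Phi>)"
proof (induction \<Phi>)
  case (Nonneg j)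
  obtain N and \<phi> h :: "real ^ 'n \<Rightarrow> nat \<Rightarrow> real"
    where "\<forall>p q. eval_pair (f j) p q = (\<Sum>i<N. h q i * \<phi> p i)"
    using eval_pair_bilinear[of "f j"] by blast
  then have "sa_holds f (Nonneg j) = (\<lambda>p q. (\<Sum>i<N. h q i * \<phi> p i) \<ge> 0)"
    by (intro ext) simp
  then show ?case by (simp only: regular_relation_bilinear)
next
  case (Zero j)
  obtain N and \<phi> h :: "real ^ 'n \<Rightarrow> nat \<Rightarrow> real"
    where "\<forall>p q. eval_pair (f j) p q = (\<Sum>i<N. h q i * \<phi> p i)"
    using eval_pair_bilinear[of "f j"] by blast
  then have "sa_holds f (Zero j) = (\<lambda>p q. (\<Sum>i<N. h q i * \<phi> p i) \<ge> 0 \<and> (\<Sum>i<N. - h q i * \<phi> p i) \<ge> 0)"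
    by (intro ext) (auto simp: sum_negf)
  moreover have "regular_relation (\<lambda>p q. (\<Sum>i<N. h q i * \<phi> p i) \<ge> 0 \<and> (\<Sum>i<N. - h q i * \<phi> p i) \<ge> 0)"
    by (intro regular_relation_conj regular_relation_bilinear)
  ultimately show ?case by simp
next
  case Truth
  have "sa_holds f Truth = (\<lambda>p q. True)" by (intro ext) simp
  \<comment> \<open>With \<open>N = 0\<close> the bilinear form is the empty sum, so its inequality
    always holds.\<close>
  then show ?case
    using regular_relation_bilinear[where N = 0 and 'x = "real ^ 'n"] by simp
next
  case (Neg \<Phi>)
  then have "regular_relation (\<lambda>p q. \<not> sa_holds f \<Phi> p q)" by (rule regular_relation_not)
  moreover have "sa_holds f (Neg \<Phi>) = (\<lambda>p q. \<not> sa_holds f \<Phi> p q)" by (intro ext) simp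
  ultimately show ?case by simp
next
  case (Conj \<Phi> \<Psi>)
  then have "regular_relation (\<lambda>p q. sa_holds f \<Phi> p q \<and> sa_holds f \<Psi> p q)" by (rule regular_relation_conj)
  moreover have "sa_holds f (Conj \<Phi> \<Psi>) = (\<lambda>p q. sa_holds f \<Phi> p q \<and> sa_holds f \<Psi> p q)" by (intro ext) simp
  ultimately show ?case by simp
next
  case (Disj \<Phi> \<Psi>)
  then have "regular_relation (\<lambda>p q. \<not> (\<not> sa_holds f \<Phi> p q \<and> \<not> sa_holds f \<Psi> p q))"
    by (intro regular_relation_not regular_relation_conj)
  moreover have "sa_holds f (Disj \<Phi> \<Psi>) = (\<lambda>p q. \<not> (\<not> sa_holds f \<Phi> p q \<and> \<not> sa_holds f \<Psi> p q))"
    by (intro ext) simp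
  ultimately show ?case by simp
qed

section \<open>Turan's theorem and selections\<close>

text \<open>Ordered pairs are counted, hence the threshold without the factor 1/2. Induction on
  \<open>d\<close>: let \<open>W\<close> be the neighbourhood of a vertex of maximum degree. Pairs
  not inside \<open>W\<close> have an end outside \<open>W\<close>, where degrees are at most
  \<open>card W\<close>, so \<open>W\<close> is dense enough to contain a clique of one vertex
  less.\<close>

lemma turan_clique:
  assumes "finite V" and "sym R" and "irrefl R" and "d \<ge> 1"
    and "(1 - 1 / real d) * (real (card V))\<^sup>2 < card (R \<inter> V \<times> V)"
  shows "\<exists>Q\<subseteq>V. card Q = d + 1 \<and> (\<forall>u\<in>Q. \<forall>v\<in>Q. u \<noteq> v \<longrightarrow> (u, v) \<in> R)"
  using \<open>d \<ge> 1\<close> assms(1,5)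
proof (induction d arbitrary: V rule: nat_induct_at_least)
  case base
  then have "R \<inter> V \<times> V \<noteq> {}" by (metis card.empty diff_self div_by_1 less_irrefl mult_zero_left of_nat_0 of_nat_1)
  then obtain u v where uv: "u \<in> V" "v \<in> V" "(u, v) \<in> R" by blast
  then have "u \<noteq> v" using \<open>irrefl R\<close> by (auto simp: irrefl_def)
  then show ?case using uv \<open>sym R\<close> by (intro exI[of _ "{u, v}"]) (auto dest: symD)
next
  case (Suc d)
  note fin = \<open>finite V\<close>
  define deg where "deg v = card {u\<in>V. (v, u) \<in> R}" for v
  have "V \<noteq> {}"
  proof
    assume "V = {}"
    then show False using Suc.prems(2) by simp
  qed
  then obtain v where v: "v \<in> V" and max: "\<And>u. u \<in> V \<Longrightarrow> deg u \<le> deg v"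
    using finite_imageI[OF fin, of deg] Max_in[of "deg ` V"] Max_ge[of "deg ` V"] by fastforce
  define W where "W = {u\<in>V. (v, u) \<in> R}"
  have W: "W \<subseteq> V" "finite W" "card W = deg v" using fin by (auto simp: W_def deg_def)
  let ?n = "real (card V)" and ?w = "real (card W)"
  have wn: "?w \<le> ?n" using card_mono[OF fin W(1)] by simp
  have card_pairs: "card (R \<inter> A \<times> V) \<le> card A * card W" if "A \<subseteq> V" for A
  proof -
    have finA: "finite A" using that fin finite_subset by blast
    have "R \<inter> A \<times> V = Sigma A (\<lambda>a. {u\<in>V. (a, u) \<in> R})" by auto
    then have "card (R \<inter> A \<times> V) = (\<Sum>a\<in>A. deg a)"
      unfolding deg_def using finA fin by (simp add: card_SigmaI)
    also have "\<dots> \<le> (\<Sum>a\<in>A. card W)" using that max W(3) by (intro sum_mono) auto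
    finally show ?thesis by simp
  qed
  have conv: "(R \<inter> W \<times> (V - W)) = (R \<inter> (V - W) \<times> W)\<inverse>"
    using \<open>sym R\<close> by (auto dest: symD)
  have "R \<inter> V \<times> V \<subseteq> (R \<inter> W \<times> W) \<union> (R \<inter> W \<times> (V - W)) \<union> (R \<inter> (V - W) \<times> V)" by auto
  then have "card (R \<inter> V \<times> V) \<le> card ((R \<inter> W \<times> W) \<union> (R \<inter> W \<times> (V - W)) \<union> (R \<inter> (V - W) \<times> V))"
    using fin W by (intro card_mono) auto
  also have "\<dots> \<le> card (R \<inter> W \<times> W) + card (R \<inter> W \<times> (V - W)) + card (R \<inter> (V - W) \<times> V)"
    by (intro order.trans[OF card_Un_le] add_mono card_Un_le order.refl)
  also have "card (R \<inter> W \<times> (V - W)) \<le> card (R \<inter> (V - W) \<times> V)"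
    unfolding conv card_inverse using fin W by (intro card_mono) auto
  also have "card (R \<inter> (V - W) \<times> V) \<le> card (V - W) * card W" by (intro card_pairs) auto
  finally have "card (R \<inter> V \<times> V) \<le> card (R \<inter> W \<times> W) + 2 * (card (V - W) * card W)" by simp
  then have "real (card (R \<inter> V \<times> V)) \<le> real (card (R \<inter> W \<times> W)) + 2 * (real (card (V - W)) * ?w)"
    by (metis (mono_tags, lifting) of_nat_add of_nat_le_iff of_nat_mult of_nat_numeral)
  moreover have "real (card (V - W)) = ?n - ?w"
    using card_Diff_subset[OF W(2,1)] card_mono[OF fin W(1)] by (simp only: of_nat_diff)
  ultimately have upper: "(1 - 1 / real (Suc d)) * ?n\<^sup>2 < real (card (R \<inter> W \<times> W)) + 2 * ((?n - ?w) * ?w)"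
    using Suc.prems(2) by simp
  have "(1 - 1 / real d) * ?w\<^sup>2 < card (R \<inter> W \<times> W)"
  proof (rule ccontr)
    assume "\<not> ?thesis"
    then have "(1 - 1 / real (Suc d)) * ?n\<^sup>2 < (1 - 1 / real d) * ?w\<^sup>2 + 2 * ((?n - ?w) * ?w)"
      using upper by linarith
    \<comment> \<open>The difference is a perfect square over a positive number, with equality at
      the class proportions of the balanced Turan graph.\<close>
    moreover have "(1 - 1 / real (Suc d)) * ?n\<^sup>2 - ((1 - 1 / real d) * ?w\<^sup>2 + 2 * ((?n - ?w) * ?w))
       = (real d * ?n - real (Suc d) * ?w)\<^sup>2 / (real d * real (Suc d))"
      using \<open>d \<ge> 1\<close> by (simp add: field_simps power2_eq_square)
    moreover have "0 \<le> (real d * ?n - real (Suc d) * ?w)\<^sup>2 / (real d * real (Suc d))" by simp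
    ultimately show False by linarith
  qed
  from Suc.IH[OF W(2) this] obtain Q where Q: "Q \<subseteq> W" "card Q = d + 1"
    "\<forall>u\<in>Q. \<forall>v\<in>Q. u \<noteq> v \<longrightarrow> (u, v) \<in> R" by blast
  have "v \<notin> W" using \<open>irrefl R\<close> by (auto simp: W_def irrefl_def)
  then have "v \<notin> Q" using Q(1) by blast
  moreover have "finite Q" using Q(1) W(2) finite_subset by blast
  moreover have "(v, u) \<in> R \<and> (u, v) \<in> R" if "u \<in> Q" for u
    using that Q(1) \<open>sym R\<close> by (auto simp: W_def dest: symD)
  ultimately show ?case
    using Q v W(1) by (intro exI[of _ "insert v Q"]) auto
qed

text \<open>Greedy choice: the sets already picked occupy at most \<open>card I - 1\<close> times
  \<open>s\<close> elements. The sets \<open>A i\<close> may coincide, as happens when several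
  clique vertices lie in the same part.\<close>

lemma disjoint_subsets_of_large_sets:
  assumes "finite I" and "\<And>i. i \<in> I \<Longrightarrow> finite (A i) \<and> card I * s \<le> card (A i)"
  shows "\<exists>C. (\<forall>i\<in>I. C i \<subseteq> A i \<and> card (C i) = s) \<and> disjoint_family_on C I"
proof -
  have "\<exists>C. (\<forall>i\<in>J. C i \<subseteq> A i \<and> card (C i) = s) \<and> disjoint_family_on C J" if "J \<subseteq> I" for J
    using finite_subset[OF that assms(1)] that
  proof (induction J rule: finite_induct)
    case (insert j J)
    then obtain C where C: "\<forall>i\<in>J. C i \<subseteq> A i \<and> card (C i) = s" "disjoint_family_on C J" by auto
    let ?U = "\<Union>i\<in>J. C i"
    have finU: "finite ?U"
      using insert.prems insert.hyps(1) C(1) assms(2) by (meson finite_UN finite_subset insert_subset subsetD)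
    have "card ?U \<le> (\<Sum>i\<in>J. card (C i))" using insert.hyps(1) by (rule card_UN_le)
    also have "\<dots> = card J * s" using C(1) by simp
    finally have "s + card ?U \<le> card (insert j J) * s" using insert.hyps by simp
    also have "\<dots> \<le> card I * s" using insert.prems assms(1) by (intro mult_right_mono card_mono) auto
    also have "\<dots> \<le> card (A j)" using assms(2) insert.prems by auto
    finally have "s \<le> card (A j) - card ?U" by simp
    also have "\<dots> \<le> card (A j - ?U)" by (intro diff_card_le_card_Diff finU)
    finally obtain B where B: "B \<subseteq> A j - ?U" "card B = s"
      by (meson obtain_subset_with_card_n)
    show ?case
      using B C insert.hyps(2)
      by (intro exI[of _ "C(j := B)"]) (auto simp: disjoint_family_on_def)
  qed (simp add: disjoint_family_on_def)
  then show ?thesis by blast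
qed

lemma card_ordered_pairs:
  assumes fin: "finite E" and E: "E \<subseteq> {{u, v} |u v. u \<in> V \<and> v \<in> V \<and> u \<noteq> v}"
  shows "card {(u, v). {u, v} \<in> E} = 2 * card E"
proof -
  define S where "S e = {(u, v). {u, v} = e}" for e :: "'a set"
  have S: "finite (S e)" "card (S e) = 2" if eE: "e \<in> E" for e
  proof -
    obtain u v where e: "e = {u, v}" "u \<noteq> v" using eE E by blast
    then have "S e = {(u, v), (v, u)}" by (auto simp: S_def doubleton_eq_iff)
    then show "finite (S e)" "card (S e) = 2" using e(2) by auto
  qed
  have "{(u, v). {u, v} \<in> E} = (\<Union>e\<in>E. S e)" by (auto simp: S_def)
  also have "card \<dots> = (\<Sum>e\<in>E. card (S e))"
    using fin S by (intro card_UN_disjoint) (auto simp: S_def)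
  also have "\<dots> = 2 * card E" using S by simp
  finally show ?thesis .
qed

section \<open>Blowing up a clique of representatives\<close>

theorem theorem4:
  fixes d s :: nat
    and f :: "nat \<Rightarrow> ('n::finite + 'n) real_mpoly"
    and \<Phi> :: "nat sa_formula"
    and \<epsilon> :: real
  assumes "d \<ge> 1"
    and "indices \<Phi> \<subseteq> {1..s}"
    and "\<epsilon> > 0"
  shows "\<exists>\<beta>::real. \<beta> > 0 \<and>
    (\<forall>(P :: (real ^ 'n) set) (E :: (real ^ 'n) set set).
      semialgebraic_graph f \<Phi> P E \<and>
      real (card E) > (1 - 1 / real d + \<epsilon>) * ((real (card P))\<^sup>2 / 2) \<longrightarrow>
      (\<exists>C :: nat \<Rightarrow> (real ^ 'n) set.
        complete_multipartite_subgraph {1..d + 1} C P E \<and>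
        (\<forall>i\<in>{1..d + 1}. int (card (C i)) \<ge> \<lfloor>\<beta> * real (card P)\<rfloor>)))"
proof -
  \<comment> \<open>Four sets of ordered pairs will be deleted: the exceptional pairs, their
    converse, and the pairs with first or second point in a small part. Each may cost a quarter of
    \<epsilon>.\<close>
  have "\<epsilon> / 4 > 0" using \<open>\<epsilon> > 0\<close> by simp
  then obtain K :: nat where K: "\<And>P. finite P \<Longrightarrow>
     \<exists>(l :: real ^ 'n \<Rightarrow> nat) Bad. card (l ` P) \<le> K \<and> Bad \<subseteq> P \<times> P \<and>
        real (card Bad) \<le> \<epsilon> / 4 * (real (card P))\<^sup>2 \<and> homogeneous_off Bad P l (sa_holds f \<Phi>)"
    using regular_relation_sa_holds[of f \<Phi>] unfolding regular_relation_def by blast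
  have cancel: "(real k + 1) * (x / (real k + 1)) = x" for k x by (simp add: add_nonneg_eq_0_iff)
  \<comment> \<open>At most \<open>K\<close> parts fall below the fraction \<open>\<gamma>\<close>,
    so together they hold at most the fraction \<open>\<epsilon> / 4\<close> of the points;
    \<open>K + 1\<close> keeps the denominator positive. In \<open>\<beta>\<close>, a part is shared
    among up to \<open>d + 1\<close> clique vertices.\<close>
  define \<gamma> where "\<gamma> = \<epsilon> / 4 / (real K + 1)"
  define \<beta> where "\<beta> = \<gamma> / (real d + 1)"
  have \<gamma>: "\<gamma> > 0" and \<beta>: "\<beta> > 0" using \<open>\<epsilon> > 0\<close> by (auto simp: \<gamma>_def \<beta>_def intro!: divide_pos_pos add_nonneg_pos)
  have "\<exists>C. complete_multipartite_subgraph {1..d + 1} C P E \<and>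
        (\<forall>i\<in>{1..d + 1}. int (card (C i)) \<ge> \<lfloor>\<beta> * real (card P)\<rfloor>)"
    if graph: "semialgebraic_graph f \<Phi> P E"
      and dense: "real (card E) > (1 - 1 / real d + \<epsilon>) * ((real (card P))\<^sup>2 / 2)"
    for P :: "(real ^ 'n) set" and E
  proof -
    let ?n = "real (card P)"
    have fin: "finite P" and E: "E \<subseteq> {{u, v} |u v. u \<in> P \<and> v \<in> P \<and> u \<noteq> v}"
      and adj: "\<And>p q. p \<in> P \<Longrightarrow> q \<in> P \<Longrightarrow> p \<noteq> q \<Longrightarrow> {p, q} \<in> E \<longleftrightarrow> sa_holds f \<Phi> p q"
      using graph by (auto simp: semialgebraic_graph_def simple_graph_def)
    have "E \<subseteq> Pow P" using E by auto
    then have finE: "finite E" using fin by (simp add: finite_subset)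
    obtain l :: "real ^ 'n \<Rightarrow> nat" and Bad where l: "card (l ` P) \<le> K" and Bad: "Bad \<subseteq> P \<times> P"
        "real (card Bad) \<le> \<epsilon> / 4 * ?n\<^sup>2"
      and hom: "homogeneous_off Bad P l (sa_holds f \<Phi>)"
      using K[OF fin] by blast
    define cls where "cls a = {p\<in>P. l p = a}" for a
    define small where "small = {p\<in>P. real (card (cls (l p))) < \<gamma> * ?n}"
    define D where "D = {(u, v). {u, v} \<in> E}"
    \<comment> \<open>Deleting the converse and both products keeps \<open>R\<close>
      symmetric.\<close>
    define R where "R = D - (Bad \<union> Bad\<inverse> \<union> small \<times> P \<union> P \<times> small)"
    have D: "D \<subseteq> P \<times> P" and D_ne: "\<And>u v. (u, v) \<in> D \<Longrightarrow> u \<noteq> v"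
      using E by (auto simp: D_def doubleton_eq_iff)
    have finD: "finite D" using D fin finite_subset by blast
    have finBad: "finite Bad" using Bad(1) fin finite_subset by blast
    have small: "small \<subseteq> P" "finite small" using fin by (auto simp: small_def)
    have card_small: "real (card small) \<le> K * (\<gamma> * ?n)"
    proof -
      have "small \<subseteq> (\<Union>a\<in>l ` small. cls a)" using small(1) by (auto simp: cls_def)
      then have "card small \<le> (\<Sum>a\<in>l ` small. card (cls a))"
        using small fin by (intro order.trans[OF card_mono card_UN_le]) (auto simp: cls_def)
      also have "real \<dots> \<le> (\<Sum>a\<in>l ` small. \<gamma> * ?n)"
        unfolding of_nat_sum by (intro sum_mono) (auto simp: small_def)
      also have "\<dots> = real (card (l ` small)) * (\<gamma> * ?n)" by simp
      also have "\<dots> \<le> K * (\<gamma> * ?n)"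
      proof (intro mult_right_mono of_nat_mono)
        have "card (l ` small) \<le> card (l ` P)" using small fin by (intro card_mono) auto
        then show "card (l ` small) \<le> K" using l by linarith
      qed (use \<gamma> in auto)
      finally show ?thesis by simp
    qed
    have "real (card D) \<le> real (card R) + \<epsilon> * ?n\<^sup>2"
    proof -
      have "D \<subseteq> R \<union> (Bad \<union> Bad\<inverse> \<union> small \<times> P \<union> P \<times> small)" by (auto simp: R_def)
      then have "card D \<le> card (R \<union> (Bad \<union> Bad\<inverse> \<union> small \<times> P \<union> P \<times> small))"
        using fin finD finBad small by (intro card_mono) (auto simp: R_def)
      also have "\<dots> \<le> card R + (card Bad + card (Bad\<inverse>) + card (small \<times> P) + card (P \<times> small))"
        by (intro order.trans[OF card_Un_le] add_mono order.refl)
      also have "\<dots> = card R + 2 * card Bad + 2 * (card small * card P)"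
        by (simp add: card_cartesian_product)
      finally have "real (card D) \<le> real (card R) + 2 * real (card Bad) + 2 * (real (card small) * ?n)"
        by (metis (mono_tags, lifting) of_nat_add of_nat_le_iff of_nat_mult of_nat_numeral)
      moreover have "real (card small) * ?n \<le> \<epsilon> / 4 * ?n\<^sup>2"
      proof -
        have "real (card small) * ?n \<le> K * (\<gamma> * ?n) * ?n" using card_small by (intro mult_right_mono) auto
        also have "\<dots> = (K * \<gamma>) * ?n\<^sup>2" by (simp add: power2_eq_square)
        also have "\<dots> \<le> \<epsilon> / 4 * ?n\<^sup>2"
        proof (rule mult_right_mono)
          have "K * \<gamma> \<le> (real K + 1) * \<gamma>" using \<gamma> by simp
          also have "\<dots> = \<epsilon> / 4" unfolding \<gamma>_def by (rule cancel)
          finally show "K * \<gamma> \<le> \<epsilon> / 4" .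
        qed simp
        finally show ?thesis .
      qed
      ultimately show ?thesis using Bad(2) by linarith
    qed
    moreover have "card D = 2 * card E" unfolding D_def by (rule card_ordered_pairs[OF finE E])
    ultimately have "(1 - 1 / real d) * ?n\<^sup>2 < card R"
      using dense by (simp add: algebra_simps)
    moreover have "R \<inter> P \<times> P = R" using D by (auto simp: R_def)
    moreover have "sym R" by (auto simp: R_def D_def sym_def insert_commute)
    moreover have "irrefl R" using D_ne by (auto simp: R_def irrefl_def)
    ultimately obtain Q where Q: "Q \<subseteq> P" "card Q = d + 1" "\<And>u v. u \<in> Q \<Longrightarrow> v \<in> Q \<Longrightarrow> u \<noteq> v \<Longrightarrow> (u, v) \<in> R"
      using turan_clique[OF fin, of R d] \<open>d \<ge> 1\<close> by metis
    have "finite Q" using Q(1) fin finite_subset by blast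
    then obtain e where e: "bij_betw e {1..d + 1} Q"
      using ex_bij_betw_nat_finite_1[of Q] Q(2) by auto
    have eQ: "e i \<in> Q" if "i \<in> {1..d + 1}" for i using e that by (auto simp: bij_betw_def)
    have eP: "e i \<in> P" if "i \<in> {1..d + 1}" for i using eQ[OF that] Q(1) by blast
    have eR: "(e i, e j) \<in> R" if "i \<in> {1..d + 1}" "j \<in> {1..d + 1}" "i \<noteq> j" for i j
      using that e eQ by (intro Q(3)) (auto simp: bij_betw_def inj_on_def)
    define t where "t = nat \<lfloor>\<beta> * ?n\<rfloor>"
    have t: "real t \<le> \<beta> * ?n" using \<beta> by (simp add: t_def)
    have large: "finite (cls (l (e i))) \<and> card {1..d + 1} * t \<le> card (cls (l (e i)))"
      if i: "i \<in> {1..d + 1}" for i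
    proof
      show "finite (cls (l (e i)))" using fin by (simp add: cls_def)
      \<comment> \<open>That the part of \<open>e i\<close> is large is read off from a pair of
        \<open>R\<close> containing \<open>e i\<close>, so a second clique vertex is required;
        \<open>d \<ge> 1\<close> provides it.\<close>
      obtain j where j: "j \<in> {1..d + 1}" "i \<noteq> j"
        using i \<open>d \<ge> 1\<close> by (cases "i = 1") (auto intro: that[of 1] that[of 2])
      have "e i \<notin> small" using eR[OF i j] eP[OF j(1)] by (auto simp: R_def)
      then have "\<gamma> * ?n \<le> card (cls (l (e i)))" using eP[OF i] by (auto simp: small_def)
      moreover have "(real d + 1) * real t \<le> (real d + 1) * (\<beta> * ?n)" using t by (intro mult_left_mono) auto
      moreover have "(real d + 1) * (\<beta> * ?n) = \<gamma> * ?n" unfolding \<beta>_def mult.assoc[symmetric] cancel ..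
      ultimately have "real (card {1..d + 1} * t) \<le> card (cls (l (e i)))" by (simp add: algebra_simps)
      then show "card {1..d + 1} * t \<le> card (cls (l (e i)))" by (simp only: of_nat_le_iff)
    qed
    obtain C where C: "\<And>i. i \<in> {1..d + 1} \<Longrightarrow> C i \<subseteq> cls (l (e i)) \<and> card (C i) = t"
      and dis: "disjoint_family_on C {1..d + 1}"
      using disjoint_subsets_of_large_sets[of "{1..d + 1}" "\<lambda>i. cls (l (e i))" t, OF _ large] by blast
    have "{u, v} \<in> E" if ij: "i \<in> {1..d + 1}" "j \<in> {1..d + 1}" "i \<noteq> j" and uv: "u \<in> C i" "v \<in> C j" for i j u v
    proof -
      have u: "u \<in> P" "l u = l (e i)" and v: "v \<in> P" "l v = l (e j)"
        using C ij uv by (auto simp: cls_def)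
      \<comment> \<open>Disjointness matters when \<open>e i\<close> and \<open>e j\<close> lie in
        the same part: the formula decides adjacency for distinct points only.\<close>
      have "u \<noteq> v" using disjoint_family_onD[OF dis ij] uv by blast
      have "(e i, e j) \<in> D" "(e i, e j) \<notin> Bad" using eR[OF ij] by (auto simp: R_def)
      then have "sa_holds f \<Phi> (e i) (e j)"
        using adj[OF eP[OF ij(1)] eP[OF ij(2)]] D_ne by (auto simp: D_def)
      then have "sa_holds f \<Phi> u v"
        using homogeneous_offD[OF hom eP[OF ij(1)] eP[OF ij(2)] u(1) v(1) \<open>(e i, e j) \<notin> Bad\<close> u(2) v(2)]
        by simp
      then show ?thesis using adj[OF u(1) v(1) \<open>u \<noteq> v\<close>] by simp
    qed
    moreover have "C i \<subseteq> P" if "i \<in> {1..d + 1}" for i using C[OF that] by (auto simp: cls_def)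
    moreover have "int (card (C i)) \<ge> \<lfloor>\<beta> * ?n\<rfloor>" if "i \<in> {1..d + 1}" for i
      using C[OF that] by (simp add: t_def)
    ultimately show ?thesis
      unfolding complete_multipartite_subgraph_def using dis by (intro exI[of _ C]) auto
  qed
  then show ?thesis using \<beta> by blast
qed

end
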